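(* Let $n\ge1$ and $p$ a prime. The radical $\mathcal{R}(n,p)$ of $\Sigma(n,p)$ equals $\ker\phi$, and it is spanned (over $\mathbb{F}_p$) by all elements $\overline{B}_q-\overline{B}_r$ with $q\approx r$, together with all $\overline{B}_q$ such that some positive integer occurs at least $p$ times as a component of $q$.
   Context: A composition of $n$ is a sequence of positive integers with sum $n$; $q\approx r$ means $r$ is a reordering of the components of $q$. The descent algebra $\Sigma_n$ has basis $\{B_q\}$ indexed by compositions of $n$ with multiplication $B_qB_r=\sum_{Z\in S(q,r)}B_{c(Z)}$, where for $q=[a_1,\dots,a_s]$, $r=[b_1,\dots,b_t]$, $S(q,r)$ is the set of $s\times t$ non-negative integer matrices with row sums $a_i$ and column sums $b_j$, and $c(Z)$ is the composition obtained by reading the entries of $Z$ row by row and omitting zeros. Let $\mathcal{Z}_n$ be the subring of integral combinations of the $B_q$ and $\Sigma(n,p)=\mathcal{Z}_n/p\mathcal{Z}_n$, an $\mathbb{F}_p$-algebra with basis $\overline{B}_q$ (images of $B_q$); $\mathcal{R}(n,p)$ denotes its (Jacobson) radical. For a composition $q=[a_1,\dots,a_r]$ let $\chi_q$ be the permutation character of $S_n$ induced from the trivial character of the Young subgroup $S_{a_1}\times\cdots\times S_{a_r}$, let $G_n$ be the ring (under pointwise operations) of integral combinations of the $\chi_q$, and let $G(n,p)$ be the $\mathbb{F}_p$-algebra obtained by reducing all character values of elements of $G_n$ modulo $p$; write $\tilde\chi_q$ for the reduction of $\chi_q$. The map $\phi:\Sigma(n,p)\to G(n,p)$ is the $\mathbb{F}_p$-linear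 map with $\phi(\overline{B}_q)=\tilde\chi_q$ for all compositions $q$; it is a surjective homomorphism of $\mathbb{F}_p$-algebras (as a consequence of Solomon's theorem that $B_q\mapsto\chi_q$ defines a ring homomorphism $\mathcal{Z}_n\to G_n$). *)

theory Defs
  imports Main "HOL-Library.Multiset" "HOL-Library.FuncSet" "HOL-Combinatorics.Permutations" "HOL-Computational_Algebra.Primes"
begin

definition comps :: "nat \<Rightarrow> nat list set" where
  "comps n = {q. (\<forall>a\<in>set q. 0 < a) \<and> sum_list q = n}"

definition Smat :: "nat list \<Rightarrow> nat list \<Rightarrow> nat list list set" where
  "Smat q r = {Z. length Z = length q
     \<and> (\<forall>i<length q. length (Z!i) = length r \<and> sum_list (Z!i) = q!i)
     \<and> (\<forall>j<length r. sum_list (map (\<lambda>row. row!j) Z) = r!j)}"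

definition cZ :: "nat list list \<Rightarrow> nat list" where
  "cZ Z = filter (\<lambda>x. x \<noteq> 0) (concat Z)"

text \<open>Structure constants: coefficient of B_c in B_q B_r.\<close>
definition mcoef :: "nat list \<Rightarrow> nat list \<Rightarrow> nat list \<Rightarrow> nat" where
  "mcoef q r c = card {Z \<in> Smat q r. cZ Z = c}"

text \<open>Elements of Sigma(n,p) = Z_n / p Z_n: coefficient functions on compositions of n,
  with coefficients the canonical representatives 0..p-1 of F_p.\<close>
definition sig_carrier :: "nat \<Rightarrow> int \<Rightarrow> (nat list \<Rightarrow> int) set" where
  "sig_carrier n p = {f. (\<forall>c. 0 \<le> f c \<and> f c < p) \<and> (\<forall>c. c \<notin> comps n \<longrightarrow> f c = 0)}"

definition sig_zero :: "nat list \<Rightarrow> int" where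
  "sig_zero = (\<lambda>c. 0)"

definition sig_add :: "int \<Rightarrow> (nat list \<Rightarrow> int) \<Rightarrow> (nat list \<Rightarrow> int) \<Rightarrow> (nat list \<Rightarrow> int)" where
  "sig_add p f g = (\<lambda>c. (f c + g c) mod p)"

definition sig_neg :: "int \<Rightarrow> (nat list \<Rightarrow> int) \<Rightarrow> (nat list \<Rightarrow> int)" where
  "sig_neg p f = (\<lambda>c. (- f c) mod p)"

definition sig_diff :: "int \<Rightarrow> (nat list \<Rightarrow> int) \<Rightarrow> (nat list \<Rightarrow> int) \<Rightarrow> (nat list \<Rightarrow> int)" where
  "sig_diff p f g = (\<lambda>c. (f c - g c) mod p)"

text \<open>Multiplication induced by B_q B_r = sum over Z in S(q,r) of B_{c(Z)}.\<close>
definition sig_mult :: "nat \<Rightarrow> int \<Rightarrow> (nat list \<Rightarrow> int) \<Rightarrow> (nat list \<Rightarrow> int) \<Rightarrow> (nat list \<Rightarrow> int)" where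
  "sig_mult n p f g = (\<lambda>c. (\<Sum>q\<in>comps n. \<Sum>r\<in>comps n. f q * g r * int (mcoef q r c)) mod p)"

definition Bbar :: "nat list \<Rightarrow> nat list \<Rightarrow> int" where
  "Bbar q = (\<lambda>c. if c = q then 1 else 0)"

definition left_ideal :: "nat \<Rightarrow> int \<Rightarrow> (nat list \<Rightarrow> int) set \<Rightarrow> bool" where
  "left_ideal n p I \<longleftrightarrow> I \<subseteq> sig_carrier n p \<and> sig_zero \<in> I
     \<and> (\<forall>x\<in>I. \<forall>y\<in>I. sig_add p x y \<in> I)
     \<and> (\<forall>x\<in>I. sig_neg p x \<in> I)
     \<and> (\<forall>a\<in>sig_carrier n p. \<forall>x\<in>I. sig_mult n p a x \<in> I)"

definition maximal_left_ideal :: "nat \<Rightarrow> int \<Rightarrow> (nat list \<Rightarrow> int) set \<Rightarrow> bool" where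
  "maximal_left_ideal n p I \<longleftrightarrow> left_ideal n p I \<and> I \<noteq> sig_carrier n p
     \<and> (\<forall>J. left_ideal n p J \<and> I \<subseteq> J \<longrightarrow> J = I \<or> J = sig_carrier n p)"

definition radical :: "nat \<Rightarrow> int \<Rightarrow> (nat list \<Rightarrow> int) set" where
  "radical n p = sig_carrier n p \<inter> \<Inter>{I. maximal_left_ideal n p I}"

text \<open>chi_q(sigma) = number of cosets of the Young subgroup S_{a_1} x ... x S_{a_r}
  fixed by sigma; cosets are identified with maps g : {0..<n} -> {0..<r} with fibre
  sizes a_i (ordered set partitions of shape q).\<close>
definition chi :: "nat \<Rightarrow> nat list \<Rightarrow> (nat \<Rightarrow> nat) \<Rightarrow> int" where
  "chi n q \<sigma> = int (card {g \<in> {..<n} \<rightarrow>\<^sub>E {..<length q}.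
       (\<forall>i<length q. card {x\<in>{..<n}. g x = i} = q!i) \<and> (\<forall>x<n. g (\<sigma> x) = g x)})"

definition phi :: "nat \<Rightarrow> int \<Rightarrow> (nat list \<Rightarrow> int) \<Rightarrow> (nat \<Rightarrow> nat) \<Rightarrow> int" where
  "phi n p f = (\<lambda>\<sigma>. (\<Sum>q\<in>comps n. f q * chi n q \<sigma>) mod p)"

definition ker_phi :: "nat \<Rightarrow> int \<Rightarrow> (nat list \<Rightarrow> int) set" where
  "ker_phi n p = {f \<in> sig_carrier n p. \<forall>\<sigma>. \<sigma> permutes {..<n} \<longrightarrow> phi n p f \<sigma> = 0}"

definition Fp_span :: "int \<Rightarrow> (nat list \<Rightarrow> int) set \<Rightarrow> (nat list \<Rightarrow> int) set" where
  "Fp_span p S = {(\<lambda>c. (\<Sum>g\<in>T. k g * g c) mod p) | T k. finite T \<and> T \<subseteq> S}"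

definition rad_gens :: "nat \<Rightarrow> nat \<Rightarrow> (nat list \<Rightarrow> int) set" where
  "rad_gens n p =
     {sig_diff (int p) (Bbar q) (Bbar r) | q r. q \<in> comps n \<and> r \<in> comps n \<and> mset q = mset r}
   \<union> {Bbar q | q. q \<in> comps n \<and> (\<exists>a>0. p \<le> count (mset q) a)}"

end

theory Submission
  imports Defs
begin

text \<open>
  For every permutation \<open>\<sigma>\<close>, evaluation of the reduced characters at \<open>\<sigma>\<close> is a ring homomorphism from
  \<open>\<Sigma>(n,p)\<close> onto \<open>F\<^sub>p\<close>, so its kernel is a maximal left ideal; hence the radical lies in \<open>ker \<phi>\<close>.
  Conversely \<open>B\<^sub>q B\<^sub>r = \<chi>\<^sub>r(\<sigma>\<^sub>q) B\<^sub>q\<close> plus terms with more parts, where \<open>\<sigma>\<^sub>q\<close> has cycle type \<open>q\<close>. A maximal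
  left ideal not containing \<open>ker \<phi>\<close> would contain an element \<open>m\<close> with \<open>\<phi>(m) = 1\<close>; right multiplication
  by \<open>m\<close> is then unitriangular, so the ideal would be everything.

  For the spanning set, \<open>\<chi>\<^sub>q\<close> depends only on the multiset of parts, and it is divisible by \<open>p\<close> when
  some part is repeated \<open>p\<close> times, because \<open>p\<close> equal labels can be exchanged. Modulo the generators,
  an element of \<open>ker \<phi>\<close> is supported on sorted compositions without \<open>p\<close> equal parts. If it is nonzero,
  take \<open>q\<close> in the support with the fewest parts: at \<open>\<sigma>\<^sub>q\<close> only \<open>\<chi>\<^sub>q\<close> contributes, with the value \<open>\<Prod> m\<^sub>a!\<close>
  over the multiplicities \<open>m\<^sub>a < p\<close> of the parts, which is a unit modulo \<open>p\<close>.
\<close>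

section \<open>Structure constants and coarsenings\<close>

lemma length_1_filter_nonzero:
  fixes xs :: "nat list"
  assumes "length (filter (\<lambda>x. x \<noteq> 0) xs) = 1"
  shows "filter (\<lambda>x. x \<noteq> 0) xs = [sum_list xs]"
proof -
  obtain y where y: "filter (\<lambda>x. x \<noteq> 0) xs = [y]"
    using assms by (metis One_nat_def length_0_conv length_Suc_conv)
  have "sum_list (filter (\<lambda>x. x \<noteq> 0) xs) = sum_list xs"
    by (induction xs) auto
  then show ?thesis using y by simp
qed

text \<open>A row with positive sum has at least one nonzero entry, so at least as many entries as
  rows are read. Equality forces a single nonzero entry per row, and this entry is the row
  sum.\<close>

lemma concat_nonzero_parts:
  fixes q :: "nat list"
  assumes "list_all2 (\<lambda>row a. sum_list row = a \<and> 0 < a) Z q"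
  defines "nz \<equiv> filter (\<lambda>x::nat. x \<noteq> 0)"
  shows "length q \<le> length (concat (map nz Z))"
    and "length (concat (map nz Z)) \<le> length q \<longleftrightarrow> (\<forall>row\<in>set Z. length (nz row) = 1)"
    and "(\<forall>row\<in>set Z. length (nz row) = 1) \<Longrightarrow> concat (map nz Z) = q"
proof -
  have "length q \<le> length (concat (map nz Z)) \<and>
    (length (concat (map nz Z)) \<le> length q \<longleftrightarrow> (\<forall>row\<in>set Z. length (nz row) = 1)) \<and>
    ((\<forall>row\<in>set Z. length (nz row) = 1) \<longrightarrow> concat (map nz Z) = q)"
    using assms(1)
  proof (induction rule: list_all2_induct)
    case Nil
    then show ?case by simp
  next
    case (Cons row Z a q)
    have "nz row \<noteq> []"
    proof
      assume "nz row = []"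
      then have "\<forall>x\<in>set row. x = 0" by (simp add: nz_def filter_empty_conv)
      then have "sum_list row = 0" by (simp add: sum_list_eq_0_iff)
      with Cons.hyps(1) show False by (metis less_irrefl)
    qed
    then have ge: "1 \<le> length (nz row)" by (simp add: Suc_leI)
    have eq: "length (nz row) = 1 \<Longrightarrow> nz row = [a]"
      using length_1_filter_nonzero Cons.hyps(1) unfolding nz_def by blast
    show ?case using Cons.IH ge eq by auto
  qed
  then show "length q \<le> length (concat (map nz Z))"
    and "length (concat (map nz Z)) \<le> length q \<longleftrightarrow> (\<forall>row\<in>set Z. length (nz row) = 1)"
    and "(\<forall>row\<in>set Z. length (nz row) = 1) \<Longrightarrow> concat (map nz Z) = q"
    by blast+
qed

lemma length_comps_le:
  assumes "q \<in> comps n"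
  shows "length q \<le> n"
proof -
  have "length q \<le> sum_list q" if "\<forall>a\<in>set q. 0 < a"
    using that by (induction q) auto
  then show ?thesis using assms by (auto simp: comps_def)
qed

lemma finite_comps: "finite (comps n)"
proof -
  have "comps n \<subseteq> {q. set q \<subseteq> {..n} \<and> length q \<le> n}"
  proof
    fix q assume q: "q \<in> comps n"
    have "set q \<subseteq> {..n}"
      using q member_le_sum_list[of _ q] by (auto simp: comps_def)
    then show "q \<in> {q. set q \<subseteq> {..n} \<and> length q \<le> n}"
      using length_comps_le[OF q] by simp
  qed
  then show ?thesis
    using finite_lists_length_le[of "{..n}" n] finite_subset by blast
qed

lemma cZ_conv: "cZ Z = concat (map (filter (\<lambda>x. x \<noteq> 0)) Z)"
  by (simp add: cZ_def filter_concat)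

lemma Smat_rows:
  assumes "Z \<in> Smat q r" and "\<forall>a\<in>set q. 0 < a"
  shows "list_all2 (\<lambda>row a. sum_list row = a \<and> 0 < a) Z q"
  using assms by (auto simp: Smat_def list_all2_conv_all_nth)

lemma cZ_eq_iff:
  assumes "Z \<in> Smat q r" and "\<forall>a\<in>set q. 0 < a"
  shows "cZ Z = q \<longleftrightarrow> (\<forall>row\<in>set Z. length (filter (\<lambda>x. x \<noteq> 0) row) = 1)"
  using concat_nonzero_parts[OF Smat_rows[OF assms]] unfolding cZ_conv by (metis order_refl)

lemma cZ_eq_if_length_le:
  assumes "Z \<in> Smat q r" and "\<forall>a\<in>set q. 0 < a" and "length (cZ Z) \<le> length q"
  shows "cZ Z = q"
  using concat_nonzero_parts[OF Smat_rows[OF assms(1,2)]] assms(3) unfolding cZ_conv by blast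

lemma sum_list_concat: "sum_list (concat Z) = sum_list (map sum_list (Z :: nat list list))"
  by (induction Z) auto

lemma cZ_in_comps:
  assumes "Z \<in> Smat q r" and "q \<in> comps n"
  shows "cZ Z \<in> comps n"
proof -
  have "map sum_list Z = q"
    using assms(1) by (auto simp: Smat_def intro: nth_equalityI)
  then have "sum_list (concat Z) = n"
    using assms(2) by (simp add: sum_list_concat comps_def)
  moreover have "sum_list (filter (\<lambda>x. x \<noteq> 0) xs) = sum_list xs" for xs :: "nat list"
    by (induction xs) auto
  ultimately show ?thesis by (auto simp: comps_def cZ_def)
qed

lemma finite_Smat: "finite (Smat q r)"
proof -
  define R where "R = {row. set row \<subseteq> {..sum_list q} \<and> length row = length r}"
  have "Smat q r \<subseteq> {Z. set Z \<subseteq> R \<and> length Z = length q}"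
  proof
    fix Z assume Z: "Z \<in> Smat q r"
    have "row \<in> R" if row: "row \<in> set Z" for row
    proof -
      obtain i where i: "i < length q" "row = Z ! i"
        using row Z by (auto simp: in_set_conv_nth Smat_def)
      have "x \<le> sum_list q" if "x \<in> set row" for x
      proof -
        have "x \<le> q ! i" using member_le_sum_list[OF that] i Z by (simp add: Smat_def)
        also have "\<dots> \<le> sum_list q" using i by (simp add: elem_le_sum_list)
        finally show ?thesis .
      qed
      then show ?thesis using i Z by (auto simp: R_def Smat_def)
    qed
    then show "Z \<in> {Z. set Z \<subseteq> R \<and> length Z = length q}"
      using Z by (auto simp: Smat_def)
  qed
  moreover have "finite R" unfolding R_def by (rule finite_lists_length_eq) simp
  ultimately show ?thesis using finite_lists_length_eq finite_subset by blast
qed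

text \<open>Triangularity of the multiplication: every row contributes at least one part, and if
  each contributes exactly one, the parts read are those of \<open>q\<close>.\<close>

lemma mcoef_nonzero_cases:
  assumes "mcoef q r c \<noteq> 0" and "q \<in> comps n"
  shows "c \<in> comps n" and "c = q \<or> length q < length c"
proof -
  obtain Z where Z: "Z \<in> Smat q r" "cZ Z = c"
    using assms(1) by (auto simp: mcoef_def card_eq_0_iff)
  have pos: "\<forall>a\<in>set q. 0 < a" using assms(2) by (simp add: comps_def)
  show "c \<in> comps n" using cZ_in_comps[OF Z(1) assms(2)] Z(2) by simp
  show "c = q \<or> length q < length c"
    using cZ_eq_if_length_le[OF Z(1) pos] Z(2) by force
qed

text \<open>Grouping the matrices by \<open>cZ Z\<close> turns sums weighted by structure constants
  into sums over matrices, the form in which products of characters arise.\<close>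

lemma sum_mcoef:
  fixes F :: "nat list \<Rightarrow> int"
  assumes "q \<in> comps n"
  shows "(\<Sum>c\<in>comps n. int (mcoef q r c) * F c) = (\<Sum>Z\<in>Smat q r. F (cZ Z))"
proof -
  have "(\<Sum>Z\<in>Smat q r. F (cZ Z)) = (\<Sum>c\<in>comps n. \<Sum>Z | Z \<in> Smat q r \<and> cZ Z = c. F (cZ Z))"
    by (rule sum.group[symmetric]) (use finite_Smat finite_comps cZ_in_comps assms in auto)
  also have "\<dots> = (\<Sum>c\<in>comps n. int (mcoef q r c) * F c)"
    by (rule sum.cong) (auto simp: mcoef_def)
  finally show ?thesis by simp
qed

text \<open>Ways to merge the parts of \<open>q\<close> into the parts of \<open>r\<close>. Their
  number is both the coefficient of B_q in B_q B_r and the value of \<open>chi n r\<close> at a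
  permutation of cycle type \<open>q\<close>; this double role links the multiplication to
  \<open>phi\<close>.\<close>

definition coarsenings :: "nat list \<Rightarrow> nat list \<Rightarrow> (nat \<Rightarrow> nat) set" where
  "coarsenings q r = {f \<in> {..<length q} \<rightarrow>\<^sub>E {..<length r}.
     \<forall>j<length r. (\<Sum>i | i < length q \<and> f i = j. q ! i) = r ! j}"

definition coarsening_matrix :: "nat list \<Rightarrow> nat list \<Rightarrow> (nat \<Rightarrow> nat) \<Rightarrow> nat list list" where
  "coarsening_matrix q r f =
     map (\<lambda>i. map (\<lambda>j. if f i = j then q ! i else 0) [0..<length r]) [0..<length q]"

lemma sum_list_map_nth: "sum_list (map h Z) = (\<Sum>i<length Z. h (Z ! i))"
  for h :: "'a \<Rightarrow> nat"
  by (simp add: sum_list_sum_nth atLeast0LessThan)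

lemma length_filter_nonzero_coarsening:
  assumes "f i < t" and "(a::nat) > 0"
  shows "length (filter (\<lambda>x. x \<noteq> 0) (map (\<lambda>j. if f i = j then a else 0) [0..<t])) = 1"
proof -
  have "{k. k < t \<and> (if f i = k then a else 0) \<noteq> 0} = {f i}"
    using assms by auto
  then show ?thesis
    by (simp add: length_filter_conv_card cong: conj_cong)
qed

text \<open>A matrix is read as \<open>q\<close> exactly if every row has a single nonzero entry,
  necessarily the row sum. The columns of these entries form a map \<open>f\<close>, and the column
  sums being \<open>r\<close> says that \<open>f\<close> is a coarsening.\<close>

lemma mcoef_diag:
  assumes "q \<in> comps n"
  shows "mcoef q r q = card (coarsenings q r)"
proof -
  have pos: "\<forall>a\<in>set q. 0 < a" using assms by (simp add: comps_def)
  then have posi: "0 < q ! i" if "i < length q" for i using that by simp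
  let ?M = "coarsening_matrix q r"
  have "bij_betw ?M (coarsenings q r) {Z \<in> Smat q r. cZ Z = q}"
  proof (rule bij_betw_imageI)
    show "inj_on ?M (coarsenings q r)"
    proof (rule inj_onI)
      fix f g assume f: "f \<in> coarsenings q r" and g: "g \<in> coarsenings q r" and eq: "?M f = ?M g"
      have fE: "f \<in> {..<length q} \<rightarrow>\<^sub>E {..<length r}" and gE: "g \<in> {..<length q} \<rightarrow>\<^sub>E {..<length r}"
        using f g by (auto simp: coarsenings_def)
      show "f = g"
      proof (rule PiE_ext[OF fE gE])
        fix i assume i: "i \<in> {..<length q}"
        then have fi: "f i < length r" using fE by auto
        \<comment> \<open>The entry in column \<open>f i\<close> is positive, while in row
          \<open>i\<close> of \<open>?M g\<close> only column \<open>g i\<close> can be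
          nonzero.\<close>
        have "?M f ! i ! f i = q ! i" and "?M g ! i ! f i = (if g i = f i then q ! i else 0)"
          using i fi by (simp_all add: coarsening_matrix_def)
        then show "f i = g i" using posi[of i] i unfolding eq by (auto split: if_splits)
      qed
    qed
    show "?M ` coarsenings q r = {Z \<in> Smat q r. cZ Z = q}"
    proof (intro equalityI subsetI)
      fix Z assume "Z \<in> ?M ` coarsenings q r"
      then obtain f where f: "f \<in> coarsenings q r" and Z: "Z = ?M f" by auto
      have fi: "f i < length r" if "i < length q" for i using f that by (auto simp: coarsenings_def)
      have "Z \<in> Smat q r"
        unfolding Smat_def mem_Collect_eq
      proof (intro conjI allI impI)
        fix j assume j: "j < length r"
        have "sum_list (map (\<lambda>row. row ! j) Z) = (\<Sum>i<length q. if f i = j then q ! i else 0)"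
          unfolding sum_list_map_nth
          by (rule sum.cong) (use j in \<open>auto simp: Z coarsening_matrix_def\<close>)
        also have "\<dots> = (\<Sum>i | i < length q \<and> f i = j. q ! i)"
          by (rule sum.mono_neutral_cong_right) auto
        finally show "sum_list (map (\<lambda>row. row ! j) Z) = r ! j"
          using f j by (simp add: coarsenings_def)
      next
        fix i assume i: "i < length q"
        have "sum_list (Z ! i) = (\<Sum>j<length r. if f i = j then q ! i else 0)"
          using i by (simp add: Z coarsening_matrix_def sum_list_sum_nth atLeast0LessThan)
        then show "sum_list (Z ! i) = q ! i"
          using fi[OF i] by simp
      qed (auto simp: Z coarsening_matrix_def)
      moreover have "\<forall>row\<in>set Z. length (filter (\<lambda>x. x \<noteq> 0) row) = 1"
        using length_filter_nonzero_coarsening[of f _ "length r"] fi posi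
        by (auto simp: Z coarsening_matrix_def simp del: filter_map)
      ultimately show "Z \<in> {Z \<in> Smat q r. cZ Z = q}"
        using cZ_eq_iff pos by blast
    next
      fix Z assume "Z \<in> {Z \<in> Smat q r. cZ Z = q}"
      then have Z: "Z \<in> Smat q r" and c: "cZ Z = q" by auto
      have lZ: "length Z = length q" and lr: "\<And>i. i < length q \<Longrightarrow> length (Z ! i) = length r"
        and rs: "\<And>i. i < length q \<Longrightarrow> sum_list (Z ! i) = q ! i"
        and cs: "\<And>j. j < length r \<Longrightarrow> sum_list (map (\<lambda>row. row ! j) Z) = r ! j"
        using Z by (auto simp: Smat_def)
      have "\<exists>j. {k. k < length r \<and> Z ! i ! k \<noteq> 0} = {j}" if i: "i < length q" for i
      proof -
        have "length (filter (\<lambda>x. x \<noteq> 0) (Z ! i)) = 1"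
          using cZ_eq_iff[OF Z pos] c lZ i by (metis nth_mem)
        then show ?thesis using lr[OF i] by (simp add: length_filter_conv_card card_1_singleton_iff)
      qed
      then obtain F where F: "\<And>i. i < length q \<Longrightarrow> {k. k < length r \<and> Z ! i ! k \<noteq> 0} = {F i}"
        by metis
      define f where "f = restrict F {..<length q}"
      have fr: "f i < length r" if "i < length q" for i using F[OF that] that by (auto simp: f_def)
      have ent: "Z ! i ! j = (if f i = j then q ! i else 0)" if i: "i < length q" and j: "j < length r" for i j
      proof -
        have z: "Z ! i ! k = 0" if "k < length r" "k \<noteq> f i" for k
        proof (rule ccontr)
          assume "Z ! i ! k \<noteq> 0"
          then have "k \<in> {F i}" unfolding F[OF i, symmetric] using that by simp
          with that i show False by (simp add: f_def)
        qed
        have "q ! i = (\<Sum>k<length r. Z ! i ! k)"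
          using rs[OF i] lr[OF i] by (simp add: sum_list_sum_nth atLeast0LessThan)
        also have "\<dots> = (\<Sum>k\<in>{f i}. Z ! i ! k)"
          by (rule sum.mono_neutral_right) (use fr[OF i] z in auto)
        finally show ?thesis using z[OF j] by auto
      qed
      have "Z = ?M f"
        by (rule nth_equalityI)
           (auto simp: coarsening_matrix_def lZ lr ent intro!: nth_equalityI)
      moreover have "f \<in> coarsenings q r"
        unfolding coarsenings_def mem_Collect_eq
      proof (intro conjI allI impI)
        show "f \<in> {..<length q} \<rightarrow>\<^sub>E {..<length r}" using fr by (auto simp: f_def)
        fix j assume j: "j < length r"
        have "(\<Sum>i | i < length q \<and> f i = j. q ! i) = (\<Sum>i<length q. if f i = j then q ! i else 0)"
          by (rule sum.mono_neutral_cong_left) auto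
        also have "\<dots> = (\<Sum>i<length q. Z ! i ! j)" using ent j by simp
        also have "\<dots> = r ! j" using cs[OF j] by (simp add: sum_list_map_nth lZ)
        finally show "(\<Sum>i | i < length q \<and> f i = j. q ! i) = r ! j" .
      qed
      ultimately show "Z \<in> ?M ` coarsenings q r" by blast
    qed
  qed
  then show ?thesis by (simp add: mcoef_def bij_betw_same_card)
qed

section \<open>Fixed colourings and the product of characters\<close>

text \<open>The set counted by \<open>chi\<close>, with an arbitrary label type so that pairs of
  labels and the cells of a matrix can serve as labels.\<close>

definition colorings :: "'a set \<Rightarrow> ('a \<Rightarrow> 'a) \<Rightarrow> 'i set \<Rightarrow> ('i \<Rightarrow> nat) \<Rightarrow> ('a \<Rightarrow> 'i) set" where
  "colorings X \<sigma> I w = {g \<in> X \<rightarrow>\<^sub>E I.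
     (\<forall>i\<in>I. card {x\<in>X. g x = i} = w i) \<and> (\<forall>x\<in>X. g (\<sigma> x) = g x)}"

lemma finite_colorings: "finite X \<Longrightarrow> finite I \<Longrightarrow> finite (colorings X \<sigma> I w)"
  unfolding colorings_def by (rule finite_subset[OF _ finite_PiE[of X "\<lambda>_. I"]]) auto

lemma chi_eq_card_colorings: "chi n q \<sigma> = int (card (colorings {..<n} \<sigma> {..<length q} ((!) q)))"
  by (simp add: chi_def colorings_def Ball_def)

text \<open>Renaming labels along a bijection leaves the colour classes unchanged, so only the
  weights have to match; the inverse bijection renames back.\<close>

lemma bij_betw_colorings:
  assumes \<sigma>: "\<And>x. x \<in> X \<Longrightarrow> \<sigma> x \<in> X" and h: "bij_betw h I J"
    and w: "\<And>i. i \<in> I \<Longrightarrow> w' (h i) = w i"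
  shows "bij_betw (\<lambda>g. restrict (h \<circ> g) X) (colorings X \<sigma> I w) (colorings X \<sigma> J w')"
proof -
  define k where "k = inv_into I h"
  have hI: "h i \<in> J" if "i \<in> I" for i using h that by (auto simp: bij_betw_def)
  have kJ: "k j \<in> I" if "j \<in> J" for j
    using bij_betw_inv_into[OF h] that by (auto simp: bij_betw_def k_def)
  have kh: "k (h i) = i" if "i \<in> I" for i using bij_betw_inv_into_left[OF h that] by (simp add: k_def)
  have hk: "h (k j) = j" if "j \<in> J" for j using bij_betw_inv_into_right[OF h that] by (simp add: k_def)
  show ?thesis
  proof (rule bij_betw_byWitness[where f' = "\<lambda>g. restrict (k \<circ> g) X"])
    show "\<forall>g\<in>colorings X \<sigma> I w. restrict (k \<circ> restrict (h \<circ> g) X) X = g"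
      by (auto simp: colorings_def kh PiE_iff extensional_def fun_eq_iff)
    show "\<forall>g\<in>colorings X \<sigma> J w'. restrict (h \<circ> restrict (k \<circ> g) X) X = g"
      by (auto simp: colorings_def hk PiE_iff extensional_def fun_eq_iff)
    show "(\<lambda>g. restrict (h \<circ> g) X) ` colorings X \<sigma> I w \<subseteq> colorings X \<sigma> J w'"
    proof (rule image_subsetI)
      fix g assume g: "g \<in> colorings X \<sigma> I w"
      have gX: "g x \<in> I" if "x \<in> X" for x using g that by (auto simp: colorings_def)
      have "card {x\<in>X. restrict (h \<circ> g) X x = j} = w' j" if j: "j \<in> J" for j
      proof -
        have "{x\<in>X. restrict (h \<circ> g) X x = j} = {x\<in>X. g x = k j}"
          using gX kh hk[OF j] by force
        then show ?thesis using g kJ[OF j] w[of "k j"] hk[OF j] by (simp add: colorings_def)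
      qed
      then show "restrict (h \<circ> g) X \<in> colorings X \<sigma> J w'"
        using g gX hI \<sigma> by (auto simp: colorings_def)
    qed
    show "(\<lambda>g. restrict (k \<circ> g) X) ` colorings X \<sigma> J w' \<subseteq> colorings X \<sigma> I w"
    proof (rule image_subsetI)
      fix g assume g: "g \<in> colorings X \<sigma> J w'"
      have gX: "g x \<in> J" if "x \<in> X" for x using g that by (auto simp: colorings_def)
      have "card {x\<in>X. restrict (k \<circ> g) X x = i} = w i" if i: "i \<in> I" for i
      proof -
        have "{x\<in>X. restrict (k \<circ> g) X x = i} = {x\<in>X. g x = h i}"
          using gX hk kh[OF i] by force
        then show ?thesis using g hI[OF i] w[OF i] by (simp add: colorings_def)
      qed
      then show "restrict (k \<circ> g) X \<in> colorings X \<sigma> I w"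
        using g gX kJ \<sigma> by (auto simp: colorings_def)
    qed
  qed
qed

text \<open>A label of weight 0 has an empty class, and a label in use has a nonempty one.\<close>

lemma colorings_drop_zero:
  assumes "finite X"
  shows "colorings X \<sigma> {i\<in>I. w i \<noteq> 0} w = colorings X \<sigma> I w"
proof -
  have ne: "w (g x) \<noteq> 0" if "g \<in> X \<rightarrow>\<^sub>E I" "\<forall>i\<in>I. card {x\<in>X. g x = i} = w i" "x \<in> X" for g x
  proof -
    have "{y\<in>X. g y = g x} \<noteq> {}" using that(3) by auto
    then have "card {y\<in>X. g y = g x} \<noteq> 0" using assms by simp
    moreover have "g x \<in> I" using that by auto
    ultimately show ?thesis using that(2) by metis
  qed
  have zero: "card {x\<in>X. g x = i} = w i"
    if "g \<in> X \<rightarrow>\<^sub>E {i\<in>I. w i \<noteq> 0}" "w i = 0" for g i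
  proof -
    have "{x\<in>X. g x = i} = {}" using PiE_mem[OF that(1)] that(2) by force
    then show ?thesis using that(2) by (metis card.empty)
  qed
  show ?thesis
  proof (intro equalityI subsetI)
    fix g assume g: "g \<in> colorings X \<sigma> {i\<in>I. w i \<noteq> 0} w"
    then have gP: "g \<in> X \<rightarrow>\<^sub>E {i\<in>I. w i \<noteq> 0}" by (simp add: colorings_def)
    then have "card {x\<in>X. g x = i} = w i" if "i \<in> I" for i
      using zero[OF gP, of i] that g by (cases "w i = 0") (auto simp: colorings_def)
    then show "g \<in> colorings X \<sigma> I w" using g by (auto simp: colorings_def)
  next
    fix g assume g: "g \<in> colorings X \<sigma> I w"
    then show "g \<in> colorings X \<sigma> {i\<in>I. w i \<noteq> 0} w"
      using ne[of g] by (auto simp: colorings_def)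
  qed
qed

text \<open>Bijections between the labels of each positive weight glue to a weight-preserving
  bijection of all labels of positive weight; the other labels drop out by
  \<open>colorings_drop_zero\<close>.\<close>

lemma card_colorings_cong:
  assumes "finite X" and "\<And>x. x \<in> X \<Longrightarrow> \<sigma> x \<in> X" and "finite I" and "finite J"
    and cards: "\<And>a. a > 0 \<Longrightarrow> card {i\<in>I. w i = a} = card {j\<in>J. w' j = a}"
  shows "card (colorings X \<sigma> I w) = card (colorings X \<sigma> J w')"
proof -
  have "\<exists>h. bij_betw h {i\<in>I. w i = a} {j\<in>J. w' j = a}" if "a > 0" for a
    using finite_same_card_bij[OF _ _ cards[OF that]] assms(3,4) by simp
  then obtain H where H: "\<And>a. a > 0 \<Longrightarrow> bij_betw (H a) {i\<in>I. w i = a} {j\<in>J. w' j = a}"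
    by metis
  define h where "h i = H (w i) i" for i
  have hJ: "h i \<in> J \<and> w' (h i) = w i" if "i \<in> I" "w i \<noteq> 0" for i
    using bij_betwE[OF H[of "w i"]] that by (auto simp: h_def)
  have "bij_betw h {i\<in>I. w i \<noteq> 0} {j\<in>J. w' j \<noteq> 0}"
  proof (rule bij_betw_imageI)
    show "inj_on h {i\<in>I. w i \<noteq> 0}"
    proof (rule inj_onI)
      fix i i' assume i: "i \<in> {i\<in>I. w i \<noteq> 0}" and i': "i' \<in> {i\<in>I. w i \<noteq> 0}" and eq: "h i = h i'"
      then have ww: "w i = w i'" using hJ[of i] hJ[of i'] by simp
      then have "inj_on (H (w i)) {k\<in>I. w k = w i}" using H[of "w i"] i by (simp add: bij_betw_def)
      then show "i = i'" using eq ww i i' by (auto simp: h_def inj_on_def)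
    qed
    show "h ` {i\<in>I. w i \<noteq> 0} = {j\<in>J. w' j \<noteq> 0}"
    proof (intro equalityI subsetI)
      fix j assume j: "j \<in> {j\<in>J. w' j \<noteq> 0}"
      then have "j \<in> H (w' j) ` {i\<in>I. w i = w' j}"
        using H[of "w' j"] by (auto simp: bij_betw_def)
      then show "j \<in> h ` {i\<in>I. w i \<noteq> 0}" using j by (force simp: h_def)
    qed (use hJ in auto)
  qed
  then have "card (colorings X \<sigma> {i\<in>I. w i \<noteq> 0} w) = card (colorings X \<sigma> {j\<in>J. w' j \<noteq> 0} w')"
    using hJ by (intro bij_betw_same_card[OF bij_betw_colorings[where h = h]]) (use assms(2) in auto)
  then show ?thesis by (simp only: colorings_drop_zero[OF assms(1)])
qed

lemma count_mset_nth: "count (mset xs) a = card {i. i < length xs \<and> xs ! i = a}"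
proof -
  have "count (mset xs) a = length (filter (\<lambda>x. x = a) xs)"
    by (metis (mono_tags, lifting) count_mset filter_cong count_list_eq_length_filter)
  then show ?thesis by (simp add: length_filter_conv_card)
qed

lemma chi_mset_cong:
  assumes "\<sigma> permutes {..<n}" and "mset q = mset r"
  shows "chi n q \<sigma> = chi n r \<sigma>"
  unfolding chi_eq_card_colorings of_nat_eq_iff
proof (rule card_colorings_cong)
  fix a :: nat
  show "card {i\<in>{..<length q}. q ! i = a} = card {j\<in>{..<length r}. r ! j = a}"
    using arg_cong[OF assms(2), of "\<lambda>M. count M a"] by (simp add: count_mset_nth)
qed (use permutes_in_image[OF assms(1)] in auto)

text \<open>The parts of \<open>cZ Z\<close> are the nonzero entries of \<open>Z\<close>, so the
  cells of \<open>Z\<close> can serve as labels; cells with entry 0 do no harm.\<close>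

lemma chi_cZ:
  assumes "\<sigma> permutes {..<n}" and Z: "Z \<in> Smat q r"
  shows "chi n (cZ Z) \<sigma> =
    int (card (colorings {..<n} \<sigma> ({..<length q} \<times> {..<length r}) (\<lambda>(i, j). Z ! i ! j)))"
  unfolding chi_eq_card_colorings of_nat_eq_iff
proof (rule card_colorings_cong)
  fix a :: nat assume a: "a > 0"
  have lZ: "length Z = length q" and lr: "\<And>i. i < length q \<Longrightarrow> length (Z ! i) = length r"
    using Z by (auto simp: Smat_def)
  have "card {i\<in>{..<length (cZ Z)}. cZ Z ! i = a} = count (mset (cZ Z)) a"
    by (simp add: count_mset_nth)
  also have "\<dots> = count (mset (concat Z)) a" using a by (simp add: cZ_def)
  also have "\<dots> = sum_list (map (\<lambda>row. count (mset row) a) Z)"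
    by (induction Z) auto
  also have "\<dots> = (\<Sum>i<length q. card {j. j < length (Z ! i) \<and> Z ! i ! j = a})"
    by (simp add: sum_list_map_nth count_mset_nth lZ)
  also have "\<dots> = (\<Sum>i<length q. card {j. j < length r \<and> Z ! i ! j = a})"
    by (simp add: lr)
  also have "\<dots> = card (SIGMA i:{..<length q}. {j. j < length r \<and> Z ! i ! j = a})"
    by simp
  also have "(SIGMA i:{..<length q}. {j. j < length r \<and> Z ! i ! j = a}) =
      {ij \<in> {..<length q} \<times> {..<length r}. (case ij of (i, j) \<Rightarrow> Z ! i ! j) = a}"
    by auto
  finally show "card {i\<in>{..<length (cZ Z)}. cZ Z ! i = a} =
      card {ij \<in> {..<length q} \<times> {..<length r}. (case ij of (i, j) \<Rightarrow> Z ! i ! j) = a}" .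
qed (use permutes_in_image[OF assms(1)] in auto)

section \<open>Products of characters as sums over matrices\<close>

lemma sum_card_fibres:
  assumes "finite A" and "finite J" and "\<And>x. x \<in> A \<Longrightarrow> h x \<in> J"
  shows "(\<Sum>j\<in>J. card {x\<in>A. h x = j}) = card A"
  using sum.group[of A J h "\<lambda>_. 1::nat"] assms by auto

text \<open>A pair of fixed colourings is one fixed colouring by pairs of labels. Its class sizes
  form a matrix with row sums \<open>q\<close> and column sums \<open>r\<close>, and sorting by this
  matrix gives the sum.\<close>

lemma chi_mult:
  assumes \<sigma>: "\<sigma> permutes {..<n}"
  shows "chi n q \<sigma> * chi n r \<sigma> = (\<Sum>Z\<in>Smat q r. chi n (cZ Z) \<sigma>)"
proof -
  define X where "X = {..<n}"
  define I where "I = {..<length q}"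
  define J where "J = {..<length r}"
  define C where "C Z = colorings X \<sigma> (I \<times> J) (\<lambda>(i, j). Z ! i ! j)" for Z :: "nat list list"
  define S where "S = colorings X \<sigma> I ((!) q) \<times> colorings X \<sigma> J ((!) r)"
  define pr where "pr = (\<lambda>(g, h). restrict (\<lambda>x. (g x, h x)) X :: nat \<Rightarrow> nat \<times> nat)"
  have fin: "finite X" "finite I" "finite J" by (auto simp: X_def I_def J_def)
  have \<sigma>X: "\<sigma> x \<in> X" if "x \<in> X" for x using permutes_in_image[OF \<sigma>] that by (simp add: X_def)
  have "bij_betw pr S (\<Union>Z\<in>Smat q r. C Z)"
  proof (rule bij_betw_imageI)
    show "inj_on pr S"
    proof (rule inj_onI, clarify)
      fix g h g' h' assume gh: "(g, h) \<in> S" "(g', h') \<in> S" and eq: "pr (g, h) = pr (g', h')"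
      have "g x = g' x \<and> h x = h' x" if "x \<in> X" for x
        using fun_cong[OF eq, of x] that by (simp add: pr_def)
      moreover have "g \<in> X \<rightarrow>\<^sub>E I" "g' \<in> X \<rightarrow>\<^sub>E I" "h \<in> X \<rightarrow>\<^sub>E J" "h' \<in> X \<rightarrow>\<^sub>E J"
        using gh by (auto simp: S_def colorings_def)
      ultimately show "g = g' \<and> h = h'" by (metis PiE_ext)
    qed
    show "pr ` S = (\<Union>Z\<in>Smat q r. C Z)"
    proof (intro equalityI subsetI)
      fix f assume "f \<in> pr ` S"
      then obtain g h where g: "g \<in> colorings X \<sigma> I ((!) q)" and h: "h \<in> colorings X \<sigma> J ((!) r)"
        and f: "f = pr (g, h)" by (auto simp: S_def)
      \<comment> \<open>The intersection sizes of the classes of \<open>g\<close> with the classes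
        of \<open>h\<close>.\<close>
      define Z where "Z = map (\<lambda>i. map (\<lambda>j. card {x\<in>X. g x = i \<and> h x = j}) [0..<length r]) [0..<length q]"
      have gI: "g x \<in> I" and hJ: "h x \<in> J" if "x \<in> X" for x
        using g h that by (auto simp: colorings_def)
      have "Z \<in> Smat q r"
        unfolding Smat_def mem_Collect_eq
      proof (intro conjI allI impI)
        fix i assume i: "i < length q"
        have "sum_list (Z ! i) = (\<Sum>j\<in>J. card {x\<in>{x\<in>X. g x = i}. h x = j})"
          using i by (simp add: Z_def sum_list_sum_nth atLeast0LessThan J_def conj_assoc)
        also have "\<dots> = card {x\<in>X. g x = i}"
          by (rule sum_card_fibres) (use fin hJ in auto)
        finally show "sum_list (Z ! i) = q ! i" using g i by (simp add: colorings_def I_def)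
      next
        fix j assume j: "j < length r"
        have "sum_list (map (\<lambda>row. row ! j) Z) = (\<Sum>i\<in>I. card {x\<in>{x\<in>X. h x = j}. g x = i})"
          unfolding sum_list_map_nth
          by (rule sum.cong) (use j in \<open>auto simp: Z_def I_def intro!: arg_cong[where f = card]\<close>)
        also have "\<dots> = card {x\<in>X. h x = j}"
          by (rule sum_card_fibres) (use fin gI in auto)
        finally show "sum_list (map (\<lambda>row. row ! j) Z) = r ! j"
          using h j by (simp add: colorings_def J_def)
      qed (auto simp: Z_def)
      moreover have "f \<in> C Z"
        unfolding C_def colorings_def mem_Collect_eq
      proof (intro conjI ballI)
        show "f \<in> X \<rightarrow>\<^sub>E I \<times> J" using gI hJ by (auto simp: f pr_def)
        show "f (\<sigma> x) = f x" if "x \<in> X" for x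
          using g h that \<sigma>X by (simp add: f pr_def colorings_def)
        fix ij assume "ij \<in> I \<times> J"
        then obtain i j where ij: "ij = (i, j)" "i < length q" "j < length r"
          by (auto simp: I_def J_def)
        have "{x\<in>X. f x = ij} = {x\<in>X. g x = i \<and> h x = j}" by (auto simp: f pr_def ij)
        then show "card {x\<in>X. f x = ij} = (case ij of (i, j) \<Rightarrow> Z ! i ! j)"
          using ij by (simp add: Z_def)
      qed
      ultimately show "f \<in> (\<Union>Z\<in>Smat q r. C Z)" by blast
    next
      fix f assume "f \<in> (\<Union>Z\<in>Smat q r. C Z)"
      then obtain Z where Z: "Z \<in> Smat q r" and f: "f \<in> C Z" by blast
      \<comment> \<open>Conversely, the two projections of a colouring by pairs recover the two
        factors.\<close>
      define g where "g = restrict (fst \<circ> f) X"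
      define h where "h = restrict (snd \<circ> f) X"
      have fIJ: "f x \<in> I \<times> J" if "x \<in> X" for x using f that by (auto simp: C_def colorings_def)
      have fc: "card {x\<in>X. f x = (i, j)} = Z ! i ! j" if "i < length q" "j < length r" for i j
        using f that by (auto simp: C_def colorings_def I_def J_def)
      have f\<sigma>: "f (\<sigma> x) = f x" if "x \<in> X" for x using f that by (simp add: C_def colorings_def)
      have "g \<in> colorings X \<sigma> I ((!) q)"
        unfolding colorings_def mem_Collect_eq
      proof (intro conjI ballI)
        show "g \<in> X \<rightarrow>\<^sub>E I" using fIJ by (auto simp: g_def mem_Times_iff)
        show "g (\<sigma> x) = g x" if "x \<in> X" for x using f\<sigma> \<sigma>X that by (simp add: g_def)
        fix i assume i: "i \<in> I"
        have "card {x\<in>X. g x = i} = (\<Sum>j\<in>J. card {x\<in>{x\<in>X. g x = i}. h x = j})"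
          by (rule sum_card_fibres[symmetric]) (use fin fIJ in \<open>auto simp: h_def mem_Times_iff\<close>)
        also have "\<dots> = (\<Sum>j\<in>J. Z ! i ! j)"
        proof (rule sum.cong)
          fix j assume "j \<in> J"
          have "{x\<in>{x\<in>X. g x = i}. h x = j} = {x\<in>X. f x = (i, j)}"
            by (auto simp: g_def h_def prod_eq_iff)
          then show "card {x\<in>{x\<in>X. g x = i}. h x = j} = Z ! i ! j"
            using fc i \<open>j \<in> J\<close> by (simp add: I_def J_def)
        qed simp
        also have "\<dots> = q ! i"
          using Z i sum_list_map_nth[of "\<lambda>x. x" "Z ! i"] by (simp add: Smat_def I_def J_def)
        finally show "card {x\<in>X. g x = i} = q ! i" .
      qed
      moreover have "h \<in> colorings X \<sigma> J ((!) r)"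
        unfolding colorings_def mem_Collect_eq
      proof (intro conjI ballI)
        show "h \<in> X \<rightarrow>\<^sub>E J" using fIJ by (auto simp: h_def mem_Times_iff)
        show "h (\<sigma> x) = h x" if "x \<in> X" for x using f\<sigma> \<sigma>X that by (simp add: h_def)
        fix j assume j: "j \<in> J"
        have "card {x\<in>X. h x = j} = (\<Sum>i\<in>I. card {x\<in>{x\<in>X. h x = j}. g x = i})"
          by (rule sum_card_fibres[symmetric]) (use fin fIJ in \<open>auto simp: g_def mem_Times_iff\<close>)
        also have "\<dots> = (\<Sum>i\<in>I. Z ! i ! j)"
        proof (rule sum.cong)
          fix i assume "i \<in> I"
          have "{x\<in>{x\<in>X. h x = j}. g x = i} = {x\<in>X. f x = (i, j)}"
            by (auto simp: g_def h_def prod_eq_iff)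
          then show "card {x\<in>{x\<in>X. h x = j}. g x = i} = Z ! i ! j"
            using fc j \<open>i \<in> I\<close> by (simp add: I_def J_def)
        qed simp
        also have "\<dots> = sum_list (map (\<lambda>row. row ! j) Z)"
          using Z by (simp add: sum_list_map_nth Smat_def I_def)
        also have "\<dots> = r ! j" using Z j by (simp add: Smat_def J_def)
        finally show "card {x\<in>X. h x = j} = r ! j" .
      qed
      moreover have "f = pr (g, h)"
        using f by (auto simp: C_def colorings_def pr_def g_def h_def fun_eq_iff PiE_iff extensional_def)
      ultimately show "f \<in> pr ` S" by (auto simp: S_def)
    qed
  qed
  then have "card S = card (\<Union>Z\<in>Smat q r. C Z)" by (rule bij_betw_same_card)
  also have "\<dots> = (\<Sum>Z\<in>Smat q r. card (C Z))"
  proof (rule card_UN_disjoint)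
    show "finite (Smat q r)" by (rule finite_Smat)
    show "\<forall>Z\<in>Smat q r. finite (C Z)" using fin by (simp add: C_def finite_colorings)
    \<comment> \<open>A colouring determines its class sizes and hence every entry of its
      matrix.\<close>
    show "\<forall>Z\<in>Smat q r. \<forall>Z'\<in>Smat q r. Z \<noteq> Z' \<longrightarrow> C Z \<inter> C Z' = {}"
    proof (intro ballI impI, rule ccontr)
      fix Z Z' assume Z: "Z \<in> Smat q r" and Z': "Z' \<in> Smat q r" and ne: "Z \<noteq> Z'"
        and "C Z \<inter> C Z' \<noteq> {}"
      then obtain f where f: "f \<in> C Z" "f \<in> C Z'" by blast
      have fc: "Z ! i ! j = Z' ! i ! j" if "i < length q" "j < length r" for i j
      proof -
        have "(i, j) \<in> I \<times> J" using that by (simp add: I_def J_def)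
        then have "card {x\<in>X. f x = (i, j)} = Z ! i ! j" "card {x\<in>X. f x = (i, j)} = Z' ! i ! j"
          using f by (auto simp: C_def colorings_def)
        then show ?thesis by simp
      qed
      have "Z = Z'"
      proof (rule nth_equalityI)
        show "length Z = length Z'" using Z Z' by (simp add: Smat_def)
        fix i assume "i < length Z"
        then have i: "i < length q" using Z by (simp add: Smat_def)
        show "Z ! i = Z' ! i"
          by (rule nth_equalityI) (use Z Z' i fc in \<open>auto simp: Smat_def\<close>)
      qed
      with ne show False ..
    qed
  qed
  finally have "int (card S) = (\<Sum>Z\<in>Smat q r. chi n (cZ Z) \<sigma>)"
    by (simp add: chi_cZ[OF \<sigma>] C_def X_def I_def J_def)
  then show ?thesis
    by (simp add: S_def chi_eq_card_colorings X_def I_def J_def card_cartesian_product)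
qed

section \<open>Character values modulo \<open>p\<close>\<close>

text \<open>Merging the cycles of all points with the same value of \<open>\<beta>\<close>, one point at a time.\<close>

lemma ex_permutation_with_given_cycles:
  fixes \<beta> :: "'a \<Rightarrow> 'b"
  assumes "finite X"
  shows "\<exists>\<sigma>. \<sigma> permutes X \<and> (\<forall>g :: 'a \<Rightarrow> 'c.
    (\<forall>x\<in>X. g (\<sigma> x) = g x) \<longleftrightarrow> (\<forall>x\<in>X. \<forall>y\<in>X. \<beta> x = \<beta> y \<longrightarrow> g x = g y))"
  using assms
proof (induction X)
  case empty
  show ?case by (intro exI[of _ id]) (auto simp: permutes_id)
next
  case (insert a X)
  then obtain \<sigma> where \<sigma>: "\<sigma> permutes X"
    and inv: "\<And>g :: 'a \<Rightarrow> 'c. (\<forall>x\<in>X. g (\<sigma> x) = g x) \<longleftrightarrow> (\<forall>x\<in>X. \<forall>y\<in>X. \<beta> x = \<beta> y \<longrightarrow> g x = g y)"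
    by blast
  have \<sigma>a: "\<sigma> a = a" using \<sigma> insert.hyps(2) by (simp add: permutes_def)
  show ?case
  proof (cases "\<exists>b\<in>X. \<beta> b = \<beta> a")
    case False
    have "\<sigma> permutes insert a X" using \<sigma> by (rule permutes_subset) auto
    moreover have "(\<forall>x\<in>insert a X. g (\<sigma> x) = g x) \<longleftrightarrow>
        (\<forall>x\<in>insert a X. \<forall>y\<in>insert a X. \<beta> x = \<beta> y \<longrightarrow> g x = g y)" for g :: "'a \<Rightarrow> 'c"
      using inv[of g] False \<sigma>a by (auto simp: eq_commute)
    ultimately show ?thesis by blast
  next
    case True
    then obtain b where b: "b \<in> X" "\<beta> b = \<beta> a" by blast
    have ab: "a \<noteq> b" using b insert.hyps(2) by auto
    \<comment> \<open>This inserts \<open>a\<close> into the cycle of \<open>b\<close>: now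
      \<open>b\<close> goes to \<open>a\<close>, and \<open>a\<close> goes to the former image of
      \<open>b\<close>.\<close>
    define \<tau> where "\<tau> = \<sigma> \<circ> transpose a b"
    have "\<tau> permutes insert a X"
      unfolding \<tau>_def using b \<sigma>
      by (intro permutes_compose permutes_swap_id permutes_subset[OF \<sigma>]) auto
    moreover have "(\<forall>x\<in>insert a X. g (\<tau> x) = g x) \<longleftrightarrow>
        (\<forall>x\<in>insert a X. \<forall>y\<in>insert a X. \<beta> x = \<beta> y \<longrightarrow> g x = g y)" for g :: "'a \<Rightarrow> 'c"
    proof -
      have \<tau>: "\<tau> a = \<sigma> b" "\<tau> b = a" "\<And>x. x \<noteq> a \<Longrightarrow> x \<noteq> b \<Longrightarrow> \<tau> x = \<sigma> x"
        using \<sigma>a by (auto simp: \<tau>_def transpose_def)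
      have "(\<forall>x\<in>insert a X. g (\<tau> x) = g x) \<longleftrightarrow> g a = g b \<and> (\<forall>x\<in>X. g (\<sigma> x) = g x)"
        using \<tau> b ab insert.hyps(2) by (metis insert_iff)
      also have "\<dots> \<longleftrightarrow> g a = g b \<and> (\<forall>x\<in>X. \<forall>y\<in>X. \<beta> x = \<beta> y \<longrightarrow> g x = g y)"
        using inv[of g] by simp
      also have "\<dots> \<longleftrightarrow> (\<forall>x\<in>insert a X. \<forall>y\<in>insert a X. \<beta> x = \<beta> y \<longrightarrow> g x = g y)"
      proof (intro iffI ballI impI conjI)
        fix x y assume L: "g a = g b \<and> (\<forall>x\<in>X. \<forall>y\<in>X. \<beta> x = \<beta> y \<longrightarrow> g x = g y)"
          and xy: "x \<in> insert a X" "y \<in> insert a X" "\<beta> x = \<beta> y"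
        \<comment> \<open>Every point can be replaced by a point of \<open>X\<close> with the same
          values of \<open>\<beta>\<close> and \<open>g\<close>; for \<open>a\<close> this is
          \<open>b\<close>.\<close>
        have rep: "\<exists>z'\<in>X. \<beta> z' = \<beta> z \<and> g z' = g z" if "z \<in> insert a X" for z
        proof (cases "z = a")
          case True
          then show ?thesis using b L by metis
        next
          case False
          then show ?thesis using that by blast
        qed
        obtain x' y' where x': "x' \<in> X" "\<beta> x' = \<beta> x" "g x' = g x"
          and y': "y' \<in> X" "\<beta> y' = \<beta> y" "g y' = g y"
          using rep xy(1,2) by blast
        have "\<beta> x' = \<beta> y'" using x'(2) y'(2) xy(3) by metis
        then have "g x' = g y'" using L x'(1) y'(1) by blast
        then show "g x = g y" using x'(3) y'(3) by metis
      next
        assume R: "\<forall>x\<in>insert a X. \<forall>y\<in>insert a X. \<beta> x = \<beta> y \<longrightarrow> g x = g y"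
        show "g a = g b" using R b by (metis insert_iff)
        fix x y assume "x \<in> X" "y \<in> X" "\<beta> x = \<beta> y"
        then show "g x = g y" using R by blast
      qed
      finally show ?thesis .
    qed
    ultimately show ?thesis by blast
  qed
qed

section \<open>Character values at a permutation of given cycle type\<close>

lemma ex_block_labelling:
  fixes q :: "nat list"
  assumes "sum_list q = n"
  shows "\<exists>\<beta>. (\<forall>x<n. \<beta> x < length q) \<and> (\<forall>i<length q. card {x\<in>{..<n}. \<beta> x = i} = q ! i)"
proof -
  \<comment> \<open>The points are cut into consecutive blocks of lengths \<open>q ! i\<close>; the
    entry at position \<open>x\<close> is the index of the block of \<open>x\<close>.\<close>
  define L where "L = concat (map (\<lambda>i. replicate (q ! i) i) [0..<length q])"
  have len: "length L = n"
    using assms by (simp add: L_def length_concat comp_def map_nth)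
  have "L ! x < length q" if "x < n" for x
  proof -
    have "L ! x \<in> set L" using that len by simp
    then show ?thesis by (auto simp: L_def)
  qed
  moreover have "card {x\<in>{..<n}. L ! x = i} = q ! i" if i: "i < length q" for i
  proof -
    have "card {x\<in>{..<n}. L ! x = i} = count (mset L) i"
      by (simp add: count_mset_nth len)
    also have "\<dots> = sum_list (map (\<lambda>k. count (mset (replicate (q ! k) k)) i) [0..<length q])"
    proof -
      have "count (mset (concat (map f xs))) i = sum_list (map (\<lambda>k. count (mset (f k)) i) xs)"
        for f :: "nat \<Rightarrow> nat list" and xs
        by (induction xs) auto
      then show ?thesis unfolding L_def .
    qed
    also have "\<dots> = (\<Sum>k<length q. if k = i then q ! k else 0)"
      by (simp add: sum_list_map_nth)
    also have "\<dots> = q ! i" using i by simp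
    finally show ?thesis .
  qed
  ultimately show ?thesis by blast
qed

text \<open>The cycles of \<open>\<sigma>\<close> are blocks of sizes \<open>q ! i\<close>. A fixed
  colouring is constant on blocks, so it amounts to a map from blocks to labels whose class sizes
  are sums of block sizes, that is, to a coarsening. One \<open>\<sigma>\<close> serves all
  \<open>r\<close>.\<close>

lemma ex_permutation_of_cycle_type:
  assumes q: "q \<in> comps n"
  shows "\<exists>\<sigma>. \<sigma> permutes {..<n} \<and> (\<forall>r. chi n r \<sigma> = int (card (coarsenings q r)))"
proof -
  obtain \<beta> where \<beta>: "\<And>x. x < n \<Longrightarrow> \<beta> x < length q"
    and \<beta>c: "\<And>i. i < length q \<Longrightarrow> card {x\<in>{..<n}. \<beta> x = i} = q ! i"
    using ex_block_labelling[of q n] q by (auto simp: comps_def)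
  obtain \<sigma> where \<sigma>: "\<sigma> permutes {..<n}"
    and inv: "\<And>g :: nat \<Rightarrow> nat. (\<forall>x\<in>{..<n}. g (\<sigma> x) = g x) \<longleftrightarrow>
      (\<forall>x\<in>{..<n}. \<forall>y\<in>{..<n}. \<beta> x = \<beta> y \<longrightarrow> g x = g y)"
    using ex_permutation_with_given_cycles[of "{..<n}" \<beta>] by auto
  have "\<exists>x<n. \<beta> x = i" if i: "i < length q" for i
  proof -
    have "card {x\<in>{..<n}. \<beta> x = i} \<noteq> 0" using \<beta>c[OF i] q i by (auto simp: comps_def)
    then show ?thesis by (auto simp: card_eq_0_iff)
  qed
  \<comment> \<open>One point is chosen in each block; composing a fixed colouring with
    \<open>s\<close> recovers the map on blocks.\<close>
  then obtain s where s: "\<And>i. i < length q \<Longrightarrow> s i < n \<and> \<beta> (s i) = i" by metis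
  have "card (coarsenings q r) = card (colorings {..<n} \<sigma> {..<length r} ((!) r))" for r
  proof -
    have fibre: "card {x\<in>{..<n}. f (\<beta> x) = j} = (\<Sum>i | i < length q \<and> f i = j. q ! i)"
      for f :: "nat \<Rightarrow> nat" and j
    proof -
      have "card {x\<in>{..<n}. f (\<beta> x) = j} =
          (\<Sum>i | i < length q \<and> f i = j. card {x\<in>{x\<in>{..<n}. f (\<beta> x) = j}. \<beta> x = i})"
        by (rule sum_card_fibres[symmetric]) (use \<beta> in auto)
      also have "\<dots> = (\<Sum>i | i < length q \<and> f i = j. q ! i)"
        by (rule sum.cong) (auto simp: \<beta>c[symmetric] intro!: arg_cong[where f = card])
      finally show ?thesis .
    qed
    have "bij_betw (\<lambda>f. restrict (f \<circ> \<beta>) {..<n}) (coarsenings q r)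
        (colorings {..<n} \<sigma> {..<length r} ((!) r))"
    proof (rule bij_betw_byWitness[where f' = "\<lambda>g. restrict (g \<circ> s) {..<length q}"])
      show "\<forall>f\<in>coarsenings q r.
          restrict (restrict (f \<circ> \<beta>) {..<n} \<circ> s) {..<length q} = f"
        using s by (auto simp: coarsenings_def fun_eq_iff PiE_iff extensional_def)
      have g\<beta>: "g (s (\<beta> x)) = g x"
        if "g \<in> colorings {..<n} \<sigma> {..<length r} ((!) r)" "x < n" for g x
      proof -
        have "\<forall>x\<in>{..<n}. \<forall>y\<in>{..<n}. \<beta> x = \<beta> y \<longrightarrow> g x = g y"
          using that(1) by (intro inv[of g, THEN iffD1]) (simp add: colorings_def)
        then show ?thesis using s[OF \<beta>[OF that(2)]] that(2) by (metis lessThan_iff)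
      qed
      then show "\<forall>g\<in>colorings {..<n} \<sigma> {..<length r} ((!) r).
          restrict (restrict (g \<circ> s) {..<length q} \<circ> \<beta>) {..<n} = g"
        using \<beta> by (auto simp: colorings_def fun_eq_iff PiE_iff extensional_def)
      show "(\<lambda>f. restrict (f \<circ> \<beta>) {..<n}) ` coarsenings q r
          \<subseteq> colorings {..<n} \<sigma> {..<length r} ((!) r)"
      proof (rule image_subsetI)
        fix f assume f: "f \<in> coarsenings q r"
        define g where "g = restrict (f \<circ> \<beta>) {..<n}"
        have "\<forall>x\<in>{..<n}. g (\<sigma> x) = g x" unfolding inv by (simp add: g_def)
        moreover have "card {x\<in>{..<n}. g x = j} = r ! j" if "j < length r" for j
        proof -
          have "{x\<in>{..<n}. g x = j} = {x\<in>{..<n}. f (\<beta> x) = j}" by (auto simp: g_def)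
          then show ?thesis using fibre[of f j] f that by (simp add: coarsenings_def)
        qed
        moreover have "g \<in> {..<n} \<rightarrow>\<^sub>E {..<length r}"
          using f \<beta> by (auto simp: g_def coarsenings_def)
        ultimately show "g \<in> colorings {..<n} \<sigma> {..<length r} ((!) r)"
          by (simp add: colorings_def)
      qed
      show "(\<lambda>g. restrict (g \<circ> s) {..<length q}) ` colorings {..<n} \<sigma> {..<length r} ((!) r)
          \<subseteq> coarsenings q r"
      proof (rule image_subsetI)
        fix g assume g: "g \<in> colorings {..<n} \<sigma> {..<length r} ((!) r)"
        define f where "f = restrict (g \<circ> s) {..<length q}"
        have f\<beta>: "f (\<beta> x) = g x" if "x < n" for x using g\<beta>[OF g that] \<beta>[OF that] by (simp add: f_def)
        have "(\<Sum>i | i < length q \<and> f i = j. q ! i) = r ! j" if "j < length r" for j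
        proof -
          have "{x\<in>{..<n}. f (\<beta> x) = j} = {x\<in>{..<n}. g x = j}" using f\<beta> by auto
          then show ?thesis using fibre[of f j] g that by (simp add: colorings_def)
        qed
        moreover have "f \<in> {..<length q} \<rightarrow>\<^sub>E {..<length r}"
          using g s by (auto simp: f_def colorings_def)
        ultimately show "f \<in> coarsenings q r" by (simp add: coarsenings_def)
      qed
    qed
    then show ?thesis by (rule bij_betw_same_card)
  qed
  then show ?thesis using \<sigma> by (auto simp: chi_eq_card_colorings)
qed

text \<open>Split the colourings by the label in \<open>I\<close> that occurs first; exchanging two labels of \<open>I\<close>
  identifies any two of the \<open>card I\<close> classes.\<close>

lemma card_dvd_chi:
  assumes \<sigma>: "\<sigma> permutes {..<n}" and I: "I \<subseteq> {..<length q}" "I \<noteq> {}"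
    and a: "\<And>i. i \<in> I \<Longrightarrow> q ! i = a" "a > 0"
  shows "int (card I) dvd chi n q \<sigma>"
proof -
  define C where "C = colorings {..<n} \<sigma> {..<length q} ((!) q)"
  \<comment> \<open>The least point with a label in \<open>I\<close>, which exists because the
    classes of these labels are nonempty.\<close>
  define first where "first g = (LEAST x. x < n \<and> g x \<in> I)" for g :: "nat \<Rightarrow> nat"
  define D where "D i = {g\<in>C. g (first g) = i}" for i
  have finI: "finite I" using I(1) finite_subset by blast
  have finC: "finite C" by (simp add: C_def finite_colorings)
  have first: "first g < n \<and> g (first g) \<in> I" if g: "g \<in> C" for g
  proof -
    obtain i where i: "i \<in> I" using I(2) by blast
    then have "card {x\<in>{..<n}. g x = i} = a" using g I a(1) by (auto simp: C_def colorings_def)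
    then have "{x\<in>{..<n}. g x = i} \<noteq> {}" using a(2) by (metis card.empty less_irrefl)
    then have "\<exists>x. x < n \<and> g x \<in> I" using i by auto
    then show ?thesis unfolding first_def by (rule LeastI_ex)
  qed
  have le: "card (D i) \<le> card (D j)" if i: "i \<in> I" and j: "j \<in> I" for i j
  proof -
    define T where "T g = restrict (transpose i j \<circ> g) {..<n}" for g :: "nat \<Rightarrow> nat"
    have bij: "bij_betw T C C"
      unfolding T_def C_def
    proof (rule bij_betw_colorings)
      show "bij_betw (transpose i j) {..<length q} {..<length q}"
        using i j I(1) by (intro permutes_imp_bij permutes_swap_id) auto
      show "q ! transpose i j k = q ! k" for k
        using a(1) i j by (simp add: transpose_def)
    qed (use permutes_in_image[OF \<sigma>] in auto)
    have "T g \<in> D j" if g: "g \<in> D i" for g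
    proof -
      have gC: "g \<in> C" and gi: "g (first g) = i" using g by (auto simp: D_def)
      \<comment> \<open>The exchange maps \<open>I\<close> to itself, so the first point stays the
        same while its label becomes \<open>j\<close>.\<close>
      have "x < n \<and> T g x \<in> I \<longleftrightarrow> x < n \<and> g x \<in> I" for x
        using i j by (auto simp: T_def transpose_def)
      then have "first (T g) = first g" by (simp add: first_def)
      moreover have "T g \<in> C" using bij gC by (auto simp: bij_betw_def)
      ultimately show ?thesis using first[OF gC] gi by (simp add: D_def T_def)
    qed
    moreover have "inj_on T (D i)"
      using bij by (auto simp: bij_betw_def D_def inj_on_def)
    moreover have "finite (D j)" using finC by (simp add: D_def)
    ultimately show ?thesis by (intro card_inj_on_le) auto
  qed
  obtain k where k: "k \<in> I" using I(2) by blast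
  have "card C = (\<Sum>i\<in>I. card (D i))"
    unfolding D_def by (rule sum_card_fibres[symmetric]) (use finC finI first in auto)
  also have "\<dots> = (\<Sum>i\<in>I. card (D k))" by (rule sum.cong) (use le k in \<open>auto intro: le_antisym\<close>)
  also have "\<dots> = card I * card (D k)" by simp
  finally show ?thesis by (simp add: chi_eq_card_colorings C_def)
qed

text \<open>These permutations form a product of symmetric groups on the fibres of
  \<open>\<beta>\<close>, so their number is a product of factorials of numbers below
  \<open>p\<close>. Adding a point \<open>a\<close> multiplies it by the size of the fibre of
  \<open>a\<close>, which lies between 1 and \<open>p - 1\<close>.\<close>

lemma card_permutes_preserving_not_dvd:
  fixes \<beta> :: "'a \<Rightarrow> 'b"
  assumes "finite X" and "prime p" and "\<And>b. card {x\<in>X. \<beta> x = b} < p"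
  shows "\<not> p dvd card {\<pi>. \<pi> permutes X \<and> (\<forall>x\<in>X. \<beta> (\<pi> x) = \<beta> x)}"
  using assms(1,3)
proof (induction X)
  case empty
  then show ?case using assms(2) by (simp add: permutes_empty prime_nat_iff)
next
  case (insert a X)
  define P where "P Y = {\<pi>. \<pi> permutes Y \<and> (\<forall>x\<in>Y. \<beta> (\<pi> x) = \<beta> x)}" for Y
  define B where "B = {x\<in>insert a X. \<beta> x = \<beta> a}"
  have card_lt: "card {x\<in>X. \<beta> x = b} < p" for b
    by (rule le_less_trans[OF card_mono insert.prems[of b]]) (use insert.hyps in auto)
  \<comment> \<open>Every permutation of the enlarged set is uniquely
    \<open>transpose a b \<circ> \<pi>\<close> with \<open>\<pi>\<close> fixing \<open>a\<close>,
    where \<open>b\<close> is the image of \<open>a\<close>. It preserves \<open>\<beta>\<close> iff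
    \<open>b\<close> lies in the fibre of \<open>a\<close> and \<open>\<pi>\<close> preserves
    \<open>\<beta>\<close>.\<close>
  have "bij_betw (\<lambda>(b, \<pi>). transpose a b \<circ> \<pi>) (B \<times> P X) (P (insert a X))"
  proof (rule bij_betw_imageI)
    show "inj_on (\<lambda>(b, \<pi>). transpose a b \<circ> \<pi>) (B \<times> P X)"
    proof (rule inj_onI, clarify)
      fix b \<pi> c \<rho> assume bp: "\<pi> \<in> P X" "\<rho> \<in> P X" and eq: "transpose a b \<circ> \<pi> = transpose a c \<circ> \<rho>"
      have "\<pi> a = a" "\<rho> a = a" using bp insert.hyps(2) by (auto simp: P_def permutes_def)
      then have bc: "b = c" using fun_cong[OF eq, of a] by simp
      have "transpose a b \<circ> (transpose a b \<circ> \<pi>) = transpose a b \<circ> (transpose a b \<circ> \<rho>)"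
        using eq bc by simp
      then show "b = c \<and> \<pi> = \<rho>" using bc by (simp add: comp_assoc[symmetric])
    qed
    show "(\<lambda>(b, \<pi>). transpose a b \<circ> \<pi>) ` (B \<times> P X) = P (insert a X)"
    proof (intro equalityI subsetI)
      fix \<tau> assume "\<tau> \<in> (\<lambda>(b, \<pi>). transpose a b \<circ> \<pi>) ` (B \<times> P X)"
      then obtain b \<pi> where b: "b \<in> B" and \<pi>: "\<pi> \<in> P X" and \<tau>: "\<tau> = transpose a b \<circ> \<pi>" by auto
      have \<pi>X: "\<pi> permutes X" using \<pi> by (simp add: P_def)
      then have "\<tau> permutes insert a X"
        unfolding \<tau> using b
        by (intro permutes_compose permutes_swap_id permutes_subset[OF \<pi>X]) (auto simp: B_def)
      moreover have "\<beta> (transpose a b x) = \<beta> x" for x using b by (simp add: transpose_def B_def)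
      moreover have "\<beta> (\<pi> x) = \<beta> x" for x
        using \<pi> permutes_not_in[OF \<pi>X, of x] by (cases "x \<in> X") (auto simp: P_def)
      ultimately show "\<tau> \<in> P (insert a X)" by (simp add: P_def \<tau>)
    next
      fix \<tau> assume \<tau>: "\<tau> \<in> P (insert a X)"
      then obtain b \<pi> where b: "b \<in> insert a X" and \<pi>: "\<pi> permutes X" and eq: "\<tau> = transpose a b \<circ> \<pi>"
      proof -
        have "\<tau> \<in> {\<tau>. \<tau> permutes insert a X}" using \<tau> by (simp add: P_def)
        then show ?thesis unfolding permutes_insert by (rule imageE) (auto intro: that)
      qed
      have \<pi>a: "\<pi> a = a" using \<pi> insert.hyps(2) by (simp add: permutes_def)
      have \<tau>\<beta>: "\<beta> (\<tau> x) = \<beta> x" if "x \<in> insert a X" for x using \<tau> that by (auto simp: P_def)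
      have \<beta>b: "\<beta> b = \<beta> a" using \<tau>\<beta>[of a] by (simp add: eq \<pi>a)
      then have "\<beta> (transpose a b x) = \<beta> x" for x by (simp add: transpose_def)
      then have "\<pi> \<in> P X" using \<tau>\<beta> \<pi> by (simp add: P_def eq)
      moreover have "b \<in> B" using b \<beta>b by (simp add: B_def)
      ultimately show "\<tau> \<in> (\<lambda>(b, \<pi>). transpose a b \<circ> \<pi>) ` (B \<times> P X)" using eq by auto
    qed
  qed
  then have "card (P (insert a X)) = card B * card (P X)"
    using bij_betw_same_card by (fastforce simp: card_cartesian_product)
  moreover have "\<not> p dvd card B"
  proof
    have "a \<in> B" "finite B" using insert.hyps by (auto simp: B_def)
    then have "0 < card B" by (auto simp: card_gt_0_iff)
    moreover assume "p dvd card B"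
    ultimately have "p \<le> card B" by (simp add: dvd_imp_le)
    then show False using insert.prems[of "\<beta> a"] by (simp add: B_def)
  qed
  moreover have "\<not> p dvd card (P X)" using insert.IH[OF card_lt] by (simp add: P_def)
  ultimately show ?case using assms(2) by (simp add: P_def prime_dvd_mult_iff)
qed

section \<open>Triangularity and diagonal of the coarsening numbers\<close>

lemma coarsening_surj:
  assumes f: "f \<in> coarsenings q r" and r: "\<forall>a\<in>set r. 0 < a" and j: "j < length r"
  shows "\<exists>i<length q. f i = j"
proof (rule ccontr)
  assume "\<not> (\<exists>i<length q. f i = j)"
  then have "{i. i < length q \<and> f i = j} = {}" by blast
  moreover have "(\<Sum>i | i < length q \<and> f i = j. q ! i) = r ! j"
    using f j by (simp add: coarsenings_def)
  ultimately have "r ! j = 0" by (metis sum.empty)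
  then show False using r j by (metis less_irrefl nth_mem)
qed

lemma coarsening_length_le:
  assumes f: "f \<in> coarsenings q r" and r: "\<forall>a\<in>set r. 0 < a"
  shows "length r \<le> length q"
proof -
  have "{..<length r} \<subseteq> f ` {..<length q}" using coarsening_surj[OF f r] by auto
  then have "card {..<length r} \<le> card (f ` {..<length q})" by (rule card_mono[rotated]) simp
  also have "\<dots> \<le> card {..<length q}" by (rule card_image_le) simp
  finally show ?thesis by simp
qed

text \<open>A coarsening onto positive parts is surjective, hence bijective between index sets of
  equal size, so every fibre consists of a single part.\<close>

lemma coarsening_same_length:
  assumes f: "f \<in> coarsenings q r" and r: "\<forall>a\<in>set r. 0 < a" and l: "length r = length q"
  shows "bij_betw f {..<length q} {..<length q}" and "\<And>i. i < length q \<Longrightarrow> r ! f i = q ! i"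
proof -
  have im: "f ` {..<length q} = {..<length q}"
    using coarsening_surj[OF f r] l f by (force simp: coarsenings_def)
  then show b: "bij_betw f {..<length q} {..<length q}"
    by (simp add: bij_betw_def eq_card_imp_inj_on)
  fix i assume i: "i < length q"
  then have "f i < length r" using im l by auto
  then have "r ! f i = (\<Sum>k | k < length q \<and> f k = f i. q ! k)" using f by (simp add: coarsenings_def)
  also have "{k. k < length q \<and> f k = f i} = {i}"
    using b i by (auto simp: bij_betw_def inj_on_def)
  finally show "r ! f i = q ! i" by simp
qed

lemma coarsening_same_length_mset:
  assumes f: "f \<in> coarsenings q r" and r: "\<forall>a\<in>set r. 0 < a" and l: "length r = length q"
  shows "mset r = mset q"
proof (rule multiset_eqI)
  fix a
  note b = coarsening_same_length[OF assms]
  have "bij_betw f {i. i < length q \<and> q ! i = a} {j. j < length r \<and> r ! j = a}"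
    using b l by (auto simp: bij_betw_def inj_on_def image_iff) (metis b(2) imageE lessThan_iff)
  then show "count (mset r) a = count (mset q) a"
    by (simp add: count_mset_nth bij_betw_same_card)
qed

text \<open>Nothing can be merged, so these coarsenings are the permutations of the positions that
  preserve the parts, and the multiplicities of the parts are the fibre sizes.\<close>

lemma not_dvd_card_coarsenings_refl:
  assumes q: "\<forall>a\<in>set q. 0 < a" and p: "prime p" and reg: "\<And>a. count (mset q) a < p"
  shows "\<not> p dvd card (coarsenings q q)"
proof -
  let ?X = "{..<length q}"
  let ?P = "{\<pi>. \<pi> permutes ?X \<and> (\<forall>i\<in>?X. q ! \<pi> i = q ! i)}"
  have "bij_betw (\<lambda>\<pi>. restrict \<pi> ?X) ?P (coarsenings q q)"
  \<comment> \<open>Outside the index range permutations are the identity and coarsenings are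
    \<open>undefined\<close>; the two maps change only these values.\<close>
  proof (rule bij_betw_byWitness[where f' = "\<lambda>f i. if i < length q then f i else i"])
    show "\<forall>\<pi>\<in>?P. (\<lambda>i. if i < length q then restrict \<pi> ?X i else i) = \<pi>"
      by (auto simp: fun_eq_iff permutes_def)
    show "\<forall>f\<in>coarsenings q q. restrict (\<lambda>i. if i < length q then f i else i) ?X = f"
      by (auto simp: coarsenings_def fun_eq_iff PiE_iff extensional_def)
    show "(\<lambda>\<pi>. restrict \<pi> ?X) ` ?P \<subseteq> coarsenings q q"
    proof (rule image_subsetI)
      fix \<pi> assume "\<pi> \<in> ?P"
      then have \<pi>: "\<pi> permutes ?X" and q\<pi>: "\<And>i. i < length q \<Longrightarrow> q ! \<pi> i = q ! i" by auto
      have "(\<Sum>i | i < length q \<and> restrict \<pi> ?X i = j. q ! i) = q ! j" if j: "j < length q" for j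
      proof -
        obtain k where k: "k < length q" "\<pi> k = j"
          using permutes_image[OF \<pi>] j by (metis imageE lessThan_iff)
        have "{i. i < length q \<and> restrict \<pi> ?X i = j} = {k}"
          using k permutes_inj[OF \<pi>] by (auto simp: inj_def)
        then show ?thesis using q\<pi>[OF k(1)] k(2) by simp
      qed
      moreover have "\<pi> i < length q" if "i < length q" for i
        using permutes_in_image[OF \<pi>, of i] that by simp
      ultimately show "restrict \<pi> ?X \<in> coarsenings q q" by (auto simp: coarsenings_def)
    qed
    show "(\<lambda>f i. if i < length q then f i else i) ` coarsenings q q \<subseteq> ?P"
    proof (rule image_subsetI)
      fix f assume "f \<in> coarsenings q q"
      note b = coarsening_same_length[OF this q refl]
      have "bij_betw (\<lambda>i. if i < length q then f i else i) ?X ?X"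
        using b(1) bij_betw_cong[of ?X "\<lambda>i. if i < length q then f i else i" f] by simp
      then show "(\<lambda>i. if i < length q then f i else i) \<in> ?P"
        using b(2) by (auto intro!: bij_imp_permutes split: if_splits)
    qed
  qed
  moreover have "\<not> p dvd card ?P"
    using reg by (intro card_permutes_preserving_not_dvd p) (simp_all add: count_mset_nth)
  ultimately show ?thesis by (simp add: bij_betw_same_card)
qed

section \<open>The algebra modulo \<open>p\<close> and its left ideals\<close>

lemma sum_mod_mult_left:
  fixes P :: int
  shows "(\<Sum>c\<in>A. (t c mod P) * u c) mod P = (\<Sum>c\<in>A. t c * u c) mod P"
proof -
  have "(\<Sum>c\<in>A. (t c mod P) * u c) mod P = (\<Sum>c\<in>A. ((t c mod P) * u c) mod P) mod P"
    by (rule mod_sum_eq[symmetric])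
  also have "\<dots> = (\<Sum>c\<in>A. (t c * u c) mod P) mod P"
    by (simp only: mod_mult_left_eq)
  also have "\<dots> = (\<Sum>c\<in>A. t c * u c) mod P" by (rule mod_sum_eq)
  finally show ?thesis .
qed

text \<open>Once the sum over \<open>c\<close> is innermost, \<open>sum_mcoef\<close> and
  \<open>chi_mult\<close> turn it into a product of character values, and the remaining double sum
  factors.\<close>

lemma phi_sig_mult:
  assumes \<sigma>: "\<sigma> permutes {..<n}"
  shows "phi n P (sig_mult n P a x) \<sigma> = (phi n P a \<sigma> * phi n P x \<sigma>) mod P"
proof -
  let ?C = "comps n"
  have "phi n P (sig_mult n P a x) \<sigma> =
      (\<Sum>c\<in>?C. (\<Sum>q\<in>?C. \<Sum>r\<in>?C. a q * x r * int (mcoef q r c)) * chi n c \<sigma>) mod P"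
    unfolding phi_def sig_mult_def by (rule sum_mod_mult_left)
  also have "(\<Sum>c\<in>?C. (\<Sum>q\<in>?C. \<Sum>r\<in>?C. a q * x r * int (mcoef q r c)) * chi n c \<sigma>) =
      (\<Sum>c\<in>?C. \<Sum>q\<in>?C. \<Sum>r\<in>?C. a q * x r * (int (mcoef q r c) * chi n c \<sigma>))"
    by (simp only: sum_distrib_right mult.assoc)
  also have "\<dots> = (\<Sum>q\<in>?C. \<Sum>c\<in>?C. \<Sum>r\<in>?C. a q * x r * (int (mcoef q r c) * chi n c \<sigma>))"
    by (rule sum.swap)
  also have "\<dots> = (\<Sum>q\<in>?C. \<Sum>r\<in>?C. \<Sum>c\<in>?C. a q * x r * (int (mcoef q r c) * chi n c \<sigma>))"
    by (rule sum.cong[OF refl], rule sum.swap)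
  also have "\<dots> = (\<Sum>q\<in>?C. \<Sum>r\<in>?C. a q * x r * (chi n q \<sigma> * chi n r \<sigma>))"
    by (intro sum.cong refl) (simp only: sum_distrib_left[symmetric] sum_mcoef chi_mult[OF \<sigma>])
  also have "\<dots> = (\<Sum>q\<in>?C. a q * chi n q \<sigma>) * (\<Sum>r\<in>?C. x r * chi n r \<sigma>)"
    by (simp add: sum_product algebra_simps)
  finally show ?thesis by (simp add: phi_def mod_mult_eq)
qed

lemma phi_sig_add: "phi n P (sig_add P f g) \<sigma> = (phi n P f \<sigma> + phi n P g \<sigma>) mod P"
  unfolding phi_def sig_add_def sum_mod_mult_left
  by (simp add: distrib_right sum.distrib mod_add_eq)

lemma phi_sig_diff: "phi n P (sig_diff P f g) \<sigma> = (phi n P f \<sigma> - phi n P g \<sigma>) mod P"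
  unfolding phi_def sig_diff_def sum_mod_mult_left
  by (simp add: left_diff_distrib sum_subtractf mod_diff_eq)

lemma phi_sig_neg: "phi n P (sig_neg P f) \<sigma> = (- phi n P f \<sigma>) mod P"
  unfolding phi_def sig_neg_def sum_mod_mult_left
  by (simp add: sum_negf mod_minus_eq)

lemma phi_sig_zero: "phi n P sig_zero \<sigma> = 0"
  by (simp add: phi_def sig_zero_def)

lemma phi_Bbar: "q \<in> comps n \<Longrightarrow> phi n P (Bbar q) \<sigma> = chi n q \<sigma> mod P"
  by (simp add: phi_def Bbar_def finite_comps if_distrib[of "\<lambda>u. u * _"] cong: if_cong)

text \<open>With a single label only the constant colouring exists. For \<open>n \<ge> 1\<close>,
  \<open>Bbar [n]\<close> thus provides an element on which \<open>phi\<close> is constantly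
  1.\<close>

lemma chi_single:
  assumes "\<sigma> permutes {..<n}"
  shows "chi n [n] \<sigma> = 1"
proof -
  have "colorings {..<n} \<sigma> {..<length [n]} ((!) [n]) = {restrict (\<lambda>_. 0) {..<n}}"
  proof (intro equalityI subsetI)
    fix g assume "g \<in> colorings {..<n} \<sigma> {..<length [n]} ((!) [n])"
    then have "g \<in> {..<n} \<rightarrow>\<^sub>E {0}" by (auto simp: colorings_def lessThan_Suc)
    then have "g = restrict (\<lambda>_. 0) {..<n}"
      by (auto simp: fun_eq_iff PiE_iff extensional_def)
    then show "g \<in> {restrict (\<lambda>_. 0) {..<n}}" by simp
  next
    fix g :: "nat \<Rightarrow> nat" assume g: "g \<in> {restrict (\<lambda>_. 0) {..<n}}"
    then have "{x\<in>{..<n}. g x = 0} = {..<n}" by auto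
    then have "card {x\<in>{..<n}. g x = 0} = n" by (metis card_lessThan)
    then show "g \<in> colorings {..<n} \<sigma> {..<length [n]} ((!) [n])"
      using g permutes_in_image[OF assms] by (auto simp: colorings_def)
  qed
  then show ?thesis by (simp add: chi_eq_card_colorings)
qed

lemma sig_carrier_sig_add: "P > 0 \<Longrightarrow> f \<in> sig_carrier n P \<Longrightarrow> g \<in> sig_carrier n P \<Longrightarrow> sig_add P f g \<in> sig_carrier n P"
  by (simp add: sig_carrier_def sig_add_def)

lemma sig_carrier_sig_neg: "P > 0 \<Longrightarrow> f \<in> sig_carrier n P \<Longrightarrow> sig_neg P f \<in> sig_carrier n P"
  by (simp add: sig_carrier_def sig_neg_def)

lemma sig_carrier_sig_diff: "P > 0 \<Longrightarrow> f \<in> sig_carrier n P \<Longrightarrow> g \<in> sig_carrier n P \<Longrightarrow> sig_diff P f g \<in> sig_carrier n P"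
  by (simp add: sig_carrier_def sig_diff_def)

lemma sig_carrier_sig_zero: "P > 0 \<Longrightarrow> sig_zero \<in> sig_carrier n P"
  by (simp add: sig_carrier_def sig_zero_def)

lemma sig_carrier_Bbar: "P > 1 \<Longrightarrow> q \<in> comps n \<Longrightarrow> Bbar q \<in> sig_carrier n P"
  by (auto simp: sig_carrier_def Bbar_def)

lemma sig_carrier_sig_mult: "P > 0 \<Longrightarrow> sig_mult n P a x \<in> sig_carrier n P"
proof -
  assume P: "P > 0"
  have "sig_mult n P a x c = 0" if c: "c \<notin> comps n" for c
  proof -
    have "mcoef q r c = 0" if "q \<in> comps n" for q r
      using mcoef_nonzero_cases(1) that c by blast
    then show ?thesis by (simp add: sig_mult_def)
  qed
  then show ?thesis using P by (auto simp: sig_carrier_def) (simp_all add: sig_mult_def)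
qed

lemma sig_carrier_mod:
  assumes "f \<in> sig_carrier n P"
  shows "f c mod P = f c"
  using assms by (simp add: sig_carrier_def)

section \<open>Subspaces and spans over the prime field\<close>

definition mod_subspace :: "int \<Rightarrow> (nat list \<Rightarrow> int) set \<Rightarrow> bool" where
  "mod_subspace P V \<longleftrightarrow> sig_zero \<in> V \<and> (\<forall>x\<in>V. \<forall>y\<in>V. sig_add P x y \<in> V)"

text \<open>A scalar can be replaced by its residue, a natural number, and natural multiples are
  repeated sums. For this reason \<open>mod_subspace\<close> asks for closure under addition
  only.\<close>

lemma mod_subspace_scale:
  assumes V: "mod_subspace P V" and P: "P > 0" and f: "f \<in> V"
  shows "(\<lambda>c. (k * f c) mod P) \<in> V"
proof -
  have nat: "(\<lambda>c. (int m * f c) mod P) \<in> V" for m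
  proof (induction m)
    case 0
    then show ?case using V by (simp add: mod_subspace_def sig_zero_def)
  next
    case (Suc m)
    have "(\<lambda>c. (int (Suc m) * f c) mod P) = sig_add P (\<lambda>c. (int m * f c) mod P) f"
      by (simp add: sig_add_def distrib_right mod_add_right_eq add.commute)
    then show ?case using V Suc f by (simp add: mod_subspace_def)
  qed
  have "int (nat (k mod P)) = k mod P" using P by simp
  then have "(\<lambda>c. (k * f c) mod P) = (\<lambda>c. (int (nat (k mod P)) * f c) mod P)"
    by (simp only: mod_mult_left_eq)
  then show ?thesis using nat by metis
qed

lemma mod_subspace_lincomb:
  assumes V: "mod_subspace P V" and P: "P > 0" and "finite S" and "\<And>s. s \<in> S \<Longrightarrow> F s \<in> V"
  shows "(\<lambda>c. (\<Sum>s\<in>S. k s * F s c) mod P) \<in> V"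
  using assms(3,4)
proof (induction S)
  case empty
  then show ?case using V by (simp add: mod_subspace_def sig_zero_def)
next
  case (insert s S)
  have "(\<lambda>c. (\<Sum>s\<in>insert s S. k s * F s c) mod P) =
      sig_add P (\<lambda>c. (k s * F s c) mod P) (\<lambda>c. (\<Sum>s\<in>S. k s * F s c) mod P)"
    using insert.hyps by (auto simp: sig_add_def mod_add_eq)
  then show ?case
    using V insert mod_subspace_scale[OF V P, of "F s" "k s"] by (simp add: mod_subspace_def)
qed

lemma left_ideal_subspace: "left_ideal n P I \<Longrightarrow> mod_subspace P I"
  by (simp add: left_ideal_def mod_subspace_def)

lemma Fp_span_superset:
  assumes "f \<in> S" and "\<And>c. f c mod P = f c"
  shows "f \<in> Fp_span P S"
proof -
  have "f = (\<lambda>c. (\<Sum>g\<in>{f}. 1 * g c) mod P)" using assms(2) by simp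
  moreover have "finite {f}" "{f} \<subseteq> S" using assms(1) by auto
  ultimately show ?thesis unfolding Fp_span_def mem_Collect_eq by (intro exI conjI)
qed

lemma mod_subspace_Fp_span: "mod_subspace P (Fp_span P S)"
  unfolding mod_subspace_def
proof (intro conjI ballI)
  have "sig_zero = (\<lambda>c. (\<Sum>g\<in>{}. 0 * g c) mod P)" by (simp add: sig_zero_def)
  then show "sig_zero \<in> Fp_span P S"
    unfolding Fp_span_def mem_Collect_eq by (intro exI[of _ "{}"] exI[of _ "\<lambda>_. 0"]) simp
  fix x y assume "x \<in> Fp_span P S" "y \<in> Fp_span P S"
  then obtain T k U l where T: "finite T" "T \<subseteq> S" "x = (\<lambda>c. (\<Sum>g\<in>T. k g * g c) mod P)"
    and U: "finite U" "U \<subseteq> S" "y = (\<lambda>c. (\<Sum>g\<in>U. l g * g c) mod P)"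
    by (auto simp: Fp_span_def)
  \<comment> \<open>Both coefficient families are extended by 0, so they add up where
    \<open>T\<close> and \<open>U\<close> overlap.\<close>
  define h where "h g = (if g \<in> T then k g else 0) + (if g \<in> U then l g else 0)" for g
  have "(\<Sum>g\<in>T \<union> U. h g * g c) = (\<Sum>g\<in>T. k g * g c) + (\<Sum>g\<in>U. l g * g c)" for c
  proof -
    have "(\<Sum>g\<in>T \<union> U. (if g \<in> T then k g else 0) * g c) = (\<Sum>g\<in>T. k g * g c)"
      by (rule sum.mono_neutral_cong_right) (use T U in auto)
    moreover have "(\<Sum>g\<in>T \<union> U. (if g \<in> U then l g else 0) * g c) = (\<Sum>g\<in>U. l g * g c)"
      by (rule sum.mono_neutral_cong_right) (use T U in auto)
    ultimately show ?thesis by (simp add: h_def distrib_right sum.distrib)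
  qed
  then have "sig_add P x y = (\<lambda>c. (\<Sum>g\<in>T \<union> U. h g * g c) mod P)"
    by (simp add: sig_add_def T U mod_add_eq)
  moreover have "finite (T \<union> U)" "T \<union> U \<subseteq> S" using T U by auto
  ultimately show "sig_add P x y \<in> Fp_span P S" unfolding Fp_span_def by blast
qed

lemma Fp_span_subset:
  assumes "mod_subspace P V" and "P > 0" and "S \<subseteq> V"
  shows "Fp_span P S \<subseteq> V"
proof
  fix f assume "f \<in> Fp_span P S"
  then obtain T k where T: "finite T" "T \<subseteq> S" "f = (\<lambda>c. (\<Sum>g\<in>T. k g * g c) mod P)"
    by (auto simp: Fp_span_def)
  then show "f \<in> V"
    using mod_subspace_lincomb[OF assms(1,2) T(1), of "\<lambda>g. g" k] assms(3) by auto
qed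

text \<open>\<open>phi\<close> is additive and multiplicative at each permutation. A singleton
  \<open>A\<close> yields the kernel of one evaluation, the set of all permutations yields
  \<open>ker_phi\<close>.\<close>

lemma left_ideal_phi_vanishing:
  assumes "P > 0" and "\<And>\<sigma>. \<sigma> \<in> A \<Longrightarrow> \<sigma> permutes {..<n}"
  shows "left_ideal n P {f \<in> sig_carrier n P. \<forall>\<sigma>\<in>A. phi n P f \<sigma> = 0}"
  using assms unfolding left_ideal_def
  by (auto simp: sig_carrier_sig_add sig_carrier_sig_neg sig_carrier_sig_zero sig_carrier_sig_mult
      phi_sig_add phi_sig_neg phi_sig_zero phi_sig_mult)

lemma left_ideal_ker_phi: "P > 0 \<Longrightarrow> left_ideal n P (ker_phi n P)"
  using left_ideal_phi_vanishing[of P "{\<sigma>. \<sigma> permutes {..<n}}" n] by (simp add: ker_phi_def)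

section \<open>Maximal left ideals and the radical\<close>

lemma sig_mult_Bbar:
  assumes q: "q \<in> comps n"
  shows "sig_mult n P (Bbar q) m c = (\<Sum>r\<in>comps n. m r * int (mcoef q r c)) mod P"
proof -
  have "(\<Sum>s\<in>comps n. \<Sum>r\<in>comps n. Bbar q s * m r * int (mcoef s r c)) =
      (\<Sum>s\<in>comps n. if s = q then \<Sum>r\<in>comps n. m r * int (mcoef q r c) else 0)"
    by (rule sum.cong) (auto simp: Bbar_def)
  also have "\<dots> = (\<Sum>r\<in>comps n. m r * int (mcoef q r c))"
    using q by (simp add: finite_comps)
  finally show ?thesis by (simp add: sig_mult_def)
qed

text \<open>Right multiplication by such an \<open>m\<close> is unitriangular with respect to the length of
  compositions.\<close>

lemma left_ideal_eq_carrier: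
  assumes I: "left_ideal n P I" and m: "m \<in> I" and P: "P > 1"
    and one: "\<And>\<sigma>. \<sigma> permutes {..<n} \<Longrightarrow> phi n P m \<sigma> = 1"
  shows "I = sig_carrier n P"
proof
  show "I \<subseteq> sig_carrier n P" using I by (simp add: left_ideal_def)
  have sub: "mod_subspace P I" using I by (rule left_ideal_subspace)
  have B: "Bbar q \<in> I" if "q \<in> comps n" for q
    using that
  \<comment> \<open>Descending induction on the number of parts: every B_s with more parts than
    \<open>q\<close> is already in \<open>I\<close>.\<close>
  proof (induction "n - length q" arbitrary: q rule: less_induct)
    case less
    note q = less.prems
    define u where "u = sig_mult n P (Bbar q) m"
    have uI: "u \<in> I" using I m sig_carrier_Bbar[OF P q] by (simp add: u_def left_ideal_def)
    have ucar: "u \<in> sig_carrier n P" using P by (simp add: u_def sig_carrier_sig_mult)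
    obtain \<sigma> where \<sigma>: "\<sigma> permutes {..<n}" and chi: "\<And>r. chi n r \<sigma> = int (card (coarsenings q r))"
      using ex_permutation_of_cycle_type[OF q] by blast
    \<comment> \<open>Diagonal structure constants and character values at \<open>\<sigma>\<close>
      count the same coarsenings, so this coefficient is the value of \<open>phi n P m\<close> at
      \<open>\<sigma>\<close>.\<close>
    have uq: "u q = 1"
      using one[OF \<sigma>] by (simp add: u_def sig_mult_Bbar[OF q] mcoef_diag[OF q] phi_def chi)
    have u0: "u c = 0" if "c \<noteq> q" "\<not> length q < length c" for c
    proof -
      have "mcoef q r c = 0" for r using mcoef_nonzero_cases(2)[OF _ q] that by blast
      then show ?thesis by (simp add: u_def sig_mult_Bbar[OF q])
    qed
    let ?L = "{s \<in> comps n. length q < length s}"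
    \<comment> \<open>Adding \<open>v\<close> cancels the terms of \<open>u\<close> with more parts
      than \<open>q\<close>.\<close>
    define v where "v = (\<lambda>c. (\<Sum>s\<in>?L. - u s * Bbar s c) mod P)"
    have "v \<in> I"
      unfolding v_def
    proof (rule mod_subspace_lincomb[OF sub])
      fix s assume s: "s \<in> ?L"
      then have "n - length s < n - length q" using length_comps_le[of s n] by auto
      then show "Bbar s \<in> I" using less.hyps s by blast
    qed (use P finite_comps in auto)
    moreover have "Bbar q = sig_add P u v"
    proof
      fix c
      have "(\<Sum>s\<in>?L. - u s * Bbar s c) = (\<Sum>s\<in>?L. if s = c then - u c else 0)"
        by (rule sum.cong) (auto simp: Bbar_def)
      also have "\<dots> = (if c \<in> ?L then - u c else 0)"
        by (simp add: finite_comps)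
      finally have v: "v c = (if c \<in> ?L then - u c else 0) mod P" by (simp add: v_def)
      consider "c = q" | "c \<in> ?L" | "c \<noteq> q" "c \<notin> ?L" by blast
      then show "Bbar q c = sig_add P u v c"
      proof cases
        case 1
        then show ?thesis using uq v P by (simp add: Bbar_def sig_add_def)
      next
        case 2
        then show ?thesis using v by (auto simp: Bbar_def sig_add_def mod_add_right_eq)
      next
        case 3
        then have "u c = 0" using u0[of c] ucar by (auto simp: sig_carrier_def)
        then show ?thesis using v 3 by (simp add: Bbar_def sig_add_def)
      qed
    qed
    ultimately show ?case using uI sub by (simp add: mod_subspace_def)
  qed
  show "sig_carrier n P \<subseteq> I"
  proof
    fix f assume f: "f \<in> sig_carrier n P"
    have "f = (\<lambda>c. (\<Sum>q\<in>comps n. f q * Bbar q c) mod P)"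
    proof
      fix c
      have "(\<Sum>q\<in>comps n. f q * Bbar q c) = (\<Sum>q\<in>comps n. if q = c then f c else 0)"
        by (rule sum.cong) (auto simp: Bbar_def)
      also have "\<dots> = f c" using f by (simp add: finite_comps sig_carrier_def)
      finally show "f c = (\<Sum>q\<in>comps n. f q * Bbar q c) mod P"
        using f by (simp add: sig_carrier_mod)
    qed
    also have "\<dots> \<in> I"
      using mod_subspace_lincomb[OF sub _ finite_comps, of n Bbar f] B P by auto
    finally show "f \<in> I" .
  qed
qed

text \<open>Evaluation at \<open>\<sigma>\<close> is a nonzero linear map to a field. A left ideal
  that contains its kernel and an element of nonzero value reaches every value by multiples of that
  element, so it is everything.\<close>

lemma maximal_left_ideal_phi_kernel:
  assumes p: "prime p" and n: "n \<ge> 1" and \<sigma>: "\<sigma> permutes {..<n}"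
  shows "maximal_left_ideal n (int p) {f \<in> sig_carrier n (int p). phi n (int p) f \<sigma> = 0}"
    (is "maximal_left_ideal n ?P ?M")
  unfolding maximal_left_ideal_def
proof (intro conjI allI impI)
  have P: "?P > 1" using p prime_gt_1_nat by auto
  show "left_ideal n ?P ?M" using left_ideal_phi_vanishing[of ?P "{\<sigma>}" n] P \<sigma> by simp
  have "[n] \<in> comps n" using n by (simp add: comps_def)
  then have "Bbar [n] \<in> sig_carrier n ?P" "Bbar [n] \<notin> ?M"
    using sig_carrier_Bbar[OF P] phi_Bbar[of "[n]" n ?P \<sigma>] chi_single[OF \<sigma>] P by auto
  then show "?M \<noteq> sig_carrier n ?P" by blast
  fix J assume J: "left_ideal n ?P J \<and> ?M \<subseteq> J"
  show "J = ?M \<or> J = sig_carrier n ?P"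
  proof (cases "J \<subseteq> ?M")
    case False
    have Jc: "J \<subseteq> sig_carrier n ?P" using J by (simp add: left_ideal_def)
    then obtain x where x: "x \<in> J" "phi n ?P x \<sigma> \<noteq> 0" using False by auto
    define t where "t = phi n ?P x \<sigma>"
    have t: "0 \<le> t" "t < ?P" "t \<noteq> 0" using P x(2) by (simp_all add: t_def phi_def)
    then have "\<not> ?P dvd t" using zdvd_not_zless by force
    then have "coprime t ?P"
      using p prime_imp_coprime[of ?P t] by (simp add: coprime_commute)
    \<comment> \<open>\<open>t'\<close> is an inverse of the value \<open>t\<close> modulo
      \<open>p\<close>.\<close>
    then obtain t' v where "t' * t + v * ?P = 1" using bezout_int[of t ?P] by auto
    then have "(t * t' + v * ?P) mod ?P = 1 mod ?P" by (simp add: mult.commute)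
    then have t': "(t * t') mod ?P = 1" using P by simp
    have sub: "mod_subspace ?P J" using J left_ideal_subspace by blast
    have "y \<in> J" if y: "y \<in> sig_carrier n ?P" for y
    proof -
      \<comment> \<open>Chosen so that \<open>k\<close> times \<open>x\<close> has the same value as
        \<open>y\<close>; their difference then lies in the kernel.\<close>
      define k where "k = t' * phi n ?P y \<sigma>"
      define z where "z = (\<lambda>c. (k * x c) mod ?P)"
      have z: "z \<in> J" unfolding z_def using mod_subspace_scale[OF sub _ x(1)] P by simp
      then have zc: "z \<in> sig_carrier n ?P" using Jc by blast
      have "phi n ?P z \<sigma> = (k * t) mod ?P"
        unfolding phi_def z_def t_def sum_mod_mult_left
        by (simp add: mult.assoc sum_distrib_left[symmetric] mod_mult_right_eq)
      also have "\<dots> = ((t * t') mod ?P * phi n ?P y \<sigma>) mod ?P"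
        unfolding mod_mult_left_eq by (simp add: k_def mult_ac)
      also have "\<dots> = phi n ?P y \<sigma>" by (simp add: t' phi_def)
      finally have "phi n ?P (sig_diff ?P y z) \<sigma> = 0" by (simp add: phi_sig_diff)
      then have "sig_diff ?P y z \<in> J" using J y zc P by (auto simp: sig_carrier_sig_diff)
      then have "sig_add ?P (sig_diff ?P y z) z \<in> J" using sub z by (simp add: mod_subspace_def)
      moreover have "sig_add ?P (sig_diff ?P y z) z = y"
        using y by (auto simp: sig_add_def sig_diff_def mod_add_left_eq sig_carrier_mod)
      ultimately show ?thesis by simp
    qed
    then show ?thesis using Jc by blast
  qed (use J in blast)
qed

text \<open>Otherwise the sum \<open>J\<close> of \<open>I\<close> and the kernel is everything by
  maximality. Writing \<open>Bbar [n]\<close> as a sum of \<open>m\<close> in \<open>I\<close> and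
  \<open>k\<close> in the kernel gives \<open>m\<close> the value 1 everywhere, and
  \<open>left_ideal_eq_carrier\<close> contradicts properness.\<close>

lemma ker_phi_subset_maximal_left_ideal:
  assumes p: "prime p" and n: "n \<ge> 1" and I: "maximal_left_ideal n (int p) I"
  shows "ker_phi n (int p) \<subseteq> I"
proof (rule ccontr)
  let ?P = "int p"
  let ?K = "ker_phi n ?P"
  assume not: "\<not> ?K \<subseteq> I"
  have P: "?P > 1" using p prime_gt_1_nat by auto
  have Il: "left_ideal n ?P I" using I by (simp add: maximal_left_ideal_def)
  have Kl: "left_ideal n ?P ?K" using P by (simp add: left_ideal_ker_phi)
  define J where "J = {sig_add ?P x k | x k. x \<in> I \<and> k \<in> ?K}"
  have addJ: "sig_add ?P x k \<in> J" if "x \<in> I" "k \<in> ?K" for x k using that by (auto simp: J_def)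
  have Ic: "x \<in> sig_carrier n ?P" if "x \<in> I" for x using Il that by (auto simp: left_ideal_def)
  have Kc: "x \<in> sig_carrier n ?P" if "x \<in> ?K" for x using that by (auto simp: ker_phi_def)
  have z: "sig_zero \<in> I" "sig_zero \<in> ?K" using Il Kl by (auto simp: left_ideal_def)
  have IJ: "I \<subseteq> J"
  proof
    fix x assume "x \<in> I"
    moreover have "sig_add ?P x sig_zero = x"
      using Ic[OF \<open>x \<in> I\<close>] by (auto simp: sig_add_def sig_zero_def sig_carrier_mod)
    ultimately show "x \<in> J" using addJ z(2) by metis
  qed
  have KJ: "?K \<subseteq> J"
  proof
    fix k assume "k \<in> ?K"
    moreover have "sig_add ?P sig_zero k = k"
      using Kc[OF \<open>k \<in> ?K\<close>] by (auto simp: sig_add_def sig_zero_def sig_carrier_mod)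
    ultimately show "k \<in> J" using addJ z(1) by metis
  qed
  have "left_ideal n ?P J"
    unfolding left_ideal_def
  proof (intro conjI ballI)
    show "J \<subseteq> sig_carrier n ?P" using Ic Kc P by (auto simp: J_def sig_carrier_sig_add)
    show "sig_zero \<in> J" using IJ z(1) by blast
  next
    fix u v assume "u \<in> J" "v \<in> J"
    then obtain x k y l where "x \<in> I" "k \<in> ?K" "u = sig_add ?P x k" "y \<in> I" "l \<in> ?K" "v = sig_add ?P y l"
      by (auto simp: J_def)
    moreover have "sig_add ?P (sig_add ?P x k) (sig_add ?P y l) = sig_add ?P (sig_add ?P x y) (sig_add ?P k l)"
      by (auto simp: sig_add_def mod_add_eq ac_simps)
    ultimately show "sig_add ?P u v \<in> J" using addJ Il Kl by (simp add: left_ideal_def)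
  next
    fix u assume "u \<in> J"
    then obtain x k where "x \<in> I" "k \<in> ?K" "u = sig_add ?P x k" by (auto simp: J_def)
    moreover have "sig_neg ?P (sig_add ?P x k) = sig_add ?P (sig_neg ?P x) (sig_neg ?P k)"
      by (auto simp: sig_add_def sig_neg_def mod_add_eq mod_minus_eq)
    ultimately show "sig_neg ?P u \<in> J" using addJ Il Kl by (simp add: left_ideal_def)
  next
    fix a u assume a: "a \<in> sig_carrier n ?P" and "u \<in> J"
    then obtain x k where xk: "x \<in> I" "k \<in> ?K" "u = sig_add ?P x k" by (auto simp: J_def)
    have "sig_mult n ?P a (sig_add ?P x k) = sig_add ?P (sig_mult n ?P a x) (sig_mult n ?P a k)"
    proof
      fix c
      have "sig_mult n ?P a (sig_add ?P x k) c =
          (\<Sum>q\<in>comps n. (\<Sum>r\<in>comps n. ((x r + k r) mod ?P) * (a q * int (mcoef q r c))) mod ?P) mod ?P"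
        unfolding sig_mult_def sig_add_def mod_sum_eq by (simp add: mult_ac)
      also have "\<dots> = (\<Sum>q\<in>comps n. \<Sum>r\<in>comps n. (x r + k r) * (a q * int (mcoef q r c))) mod ?P"
        unfolding sum_mod_mult_left mod_sum_eq ..
      also have "\<dots> = sig_add ?P (sig_mult n ?P a x) (sig_mult n ?P a k) c"
        by (simp add: sig_add_def sig_mult_def mod_add_eq distrib_right distrib_left sum.distrib mult_ac)
      finally show "sig_mult n ?P a (sig_add ?P x k) c =
        sig_add ?P (sig_mult n ?P a x) (sig_mult n ?P a k) c" .
    qed
    then show "sig_mult n ?P a u \<in> J" using xk addJ Il Kl a by (simp add: left_ideal_def)
  qed
  then have "J = sig_carrier n ?P"
    using I IJ KJ not unfolding maximal_left_ideal_def by blast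
  moreover have n1: "[n] \<in> comps n" using n by (simp add: comps_def)
  ultimately have "Bbar [n] \<in> J" using sig_carrier_Bbar[OF P] by blast
  then obtain m k where m: "m \<in> I" and k: "k \<in> ?K" and eq: "Bbar [n] = sig_add ?P m k"
    by (auto simp: J_def)
  have "phi n ?P m \<sigma> = 1" if \<sigma>: "\<sigma> permutes {..<n}" for \<sigma>
  proof -
    have "1 = phi n ?P (Bbar [n]) \<sigma>" using phi_Bbar[OF n1] chi_single[OF \<sigma>] P by simp
    also have "\<dots> = phi n ?P m \<sigma>" using k \<sigma> by (simp add: eq phi_sig_add ker_phi_def) (simp add: phi_def)
    finally show ?thesis by simp
  qed
  then have "I = sig_carrier n ?P" by (rule left_ideal_eq_carrier[OF Il m P])
  then show False using I by (simp add: maximal_left_ideal_def)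
qed

lemma radical_eq_ker_phi:
  assumes p: "prime p" and n: "n \<ge> 1"
  shows "radical n (int p) = ker_phi n (int p)"
proof
  show "radical n (int p) \<subseteq> ker_phi n (int p)"
    using maximal_left_ideal_phi_kernel[OF p n] by (auto simp: radical_def ker_phi_def)
  show "ker_phi n (int p) \<subseteq> radical n (int p)"
    using ker_phi_subset_maximal_left_ideal[OF p n] by (auto simp: radical_def) (auto simp: ker_phi_def)
qed

section \<open>Generators of the kernel\<close>

lemma rad_gens_subset_ker_phi:
  assumes p: "prime p"
  shows "rad_gens n p \<subseteq> ker_phi n (int p)"
proof
  have P: "int p > 1" using p prime_gt_1_nat by auto
  fix f assume "f \<in> rad_gens n p"
  then consider
      (diff) q r where "q \<in> comps n" "r \<in> comps n" "mset q = mset r" "f = sig_diff (int p) (Bbar q) (Bbar r)"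
    | (rep) q a where "q \<in> comps n" "a > 0" "p \<le> count (mset q) a" "f = Bbar q"
    by (auto simp: rad_gens_def)
  then show "f \<in> ker_phi n (int p)"
  proof cases
    case diff
    then show ?thesis
      using chi_mset_cong[OF _ diff(3)] P
      by (simp add: ker_phi_def sig_carrier_sig_diff sig_carrier_Bbar phi_sig_diff phi_Bbar)
  next
    case rep
    \<comment> \<open>Exactly \<open>p\<close> positions carrying the part \<open>a\<close> are
      selected, so that \<open>card_dvd_chi\<close> gives the divisor \<open>p\<close>.\<close>
    have "p \<le> card {i. i < length q \<and> q ! i = a}" using rep(3) by (simp add: count_mset_nth)
    then obtain I where I: "I \<subseteq> {i. i < length q \<and> q ! i = a}" "card I = p"
      by (meson obtain_subset_with_card_n)
    have "int p dvd chi n q \<sigma>" if "\<sigma> permutes {..<n}" for \<sigma>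
    proof -
      have "I \<noteq> {}" using I(2) P by auto
      moreover have "I \<subseteq> {..<length q}" "\<And>i. i \<in> I \<Longrightarrow> q ! i = a" using I(1) by auto
      ultimately show ?thesis using card_dvd_chi[OF that, of I q a] I(2) rep(2) by simp
    qed
    then show ?thesis using rep P by (simp add: ker_phi_def sig_carrier_Bbar phi_Bbar)
  qed
qed

text \<open>Sorted compositions represent each multiset of parts once. For those with no part
  repeated \<open>p\<close> times, the matrix of character values at their cycle types, ordered by
  number of parts, is triangular with diagonal prime to \<open>p\<close>.\<close>

lemma ker_phi_regular_sorted_zero:
  assumes p: "prime p" and f: "f \<in> ker_phi n (int p)"
    and supp: "\<And>c. f c \<noteq> 0 \<Longrightarrow> sorted c \<and> (\<forall>a. count (mset c) a < p)"
  shows "f = sig_zero"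
proof (rule ccontr)
  let ?P = "int p"
  assume "f \<noteq> sig_zero"
  then have "\<exists>c. f c \<noteq> 0" by (auto simp: sig_zero_def fun_eq_iff)
  then obtain q where fq: "f q \<noteq> 0" and min: "\<And>c. f c \<noteq> 0 \<Longrightarrow> length q \<le> length c"
    using ex_has_least_nat[of "\<lambda>c. f c \<noteq> 0" _ length] by blast
  have fcar: "f \<in> sig_carrier n ?P" using f by (simp add: ker_phi_def)
  then have q: "q \<in> comps n" using fq by (auto simp: sig_carrier_def)
  obtain \<sigma> where \<sigma>: "\<sigma> permutes {..<n}" and chi: "\<And>r. chi n r \<sigma> = int (card (coarsenings q r))"
    using ex_permutation_of_cycle_type[OF q] by blast
  \<comment> \<open>A nonzero value needs a coarsening, so \<open>r\<close> has at most as many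
    parts as \<open>q\<close>, by minimality equally many. Then \<open>r\<close> rearranges
    \<open>q\<close>, and both are sorted.\<close>
  have "f r * chi n r \<sigma> = 0" if r: "r \<in> comps n" "r \<noteq> q" for r
  proof (rule ccontr)
    assume "f r * chi n r \<sigma> \<noteq> 0"
    then have fr: "f r \<noteq> 0" and "coarsenings q r \<noteq> {}" by (auto simp: chi)
    then obtain g where g: "g \<in> coarsenings q r" by blast
    have pos: "\<forall>a\<in>set r. 0 < a" using r by (simp add: comps_def)
    have "length r = length q" using coarsening_length_le[OF g pos] min[OF fr] by simp
    then have "mset r = mset q" by (rule coarsening_same_length_mset[OF g pos])
    then have "r = q" using supp[OF fr] supp[OF fq] by (metis properties_for_sort)
    then show False using r by simp
  qed
  then have "(\<Sum>r\<in>comps n. f r * chi n r \<sigma>) = f q * chi n q \<sigma>"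
    using sum.mono_neutral_right[of "comps n" "{q}" "\<lambda>r. f r * chi n r \<sigma>"] q finite_comps by auto
  moreover have "phi n ?P f \<sigma> = 0" using f \<sigma> by (simp add: ker_phi_def)
  ultimately have "(f q * chi n q \<sigma>) mod ?P = 0" by (simp add: phi_def)
  then have "?P dvd f q * chi n q \<sigma>" by auto
  then have "?P dvd f q \<or> p dvd card (coarsenings q q)"
    using p by (simp add: prime_dvd_mult_iff chi)
  moreover have "\<not> p dvd card (coarsenings q q)"
    using q supp[OF fq] by (intro not_dvd_card_coarsenings_refl p) (auto simp: comps_def)
  ultimately have "?P dvd f q" by blast
  moreover have "0 < f q" "f q < ?P" using fq fcar by (auto simp: sig_carrier_def order_le_less)
  ultimately show False by (simp add: zdvd_not_zless)
qed

text \<open>Subtracting generators moves the coefficients of regular compositions to their sorted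
  forms and deletes the others. The remainder still lies in the kernel, so it vanishes by
  \<open>ker_phi_regular_sorted_zero\<close>.\<close>

lemma ker_phi_subset_span:
  assumes p: "prime p"
  shows "ker_phi n (int p) \<subseteq> Fp_span (int p) (rad_gens n p)"
proof
  let ?P = "int p"
  let ?S = "Fp_span ?P (rad_gens n p)"
  have P: "?P > 1" using p prime_gt_1_nat by auto
  fix f assume f: "f \<in> ker_phi n ?P"
  have fcar: "f \<in> sig_carrier n ?P" using f by (simp add: ker_phi_def)
  define reg where "reg q \<longleftrightarrow> (\<forall>a>0. count (mset q) a < p)" for q :: "nat list"
  \<comment> \<open>The generator to be subtracted \<open>f q\<close> times; it is zero if
    \<open>q\<close> is regular and already sorted.\<close>
  define D where "D q = (if reg q then sig_diff ?P (Bbar q) (Bbar (sort q)) else Bbar q)" for q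
  define d where "d = (\<lambda>c. (\<Sum>q\<in>comps n. f q * D q c) mod ?P)"
  have sort_comps: "sort q \<in> comps n" if "q \<in> comps n" for q
    using that by (simp add: comps_def) (metis mset_sort sum_mset_sum_list)
  have "D q \<in> ?S" if q: "q \<in> comps n" for q
  proof (rule Fp_span_superset)
    show "D q \<in> rad_gens n p"
    proof (cases "reg q")
      case True
      then have "D q = sig_diff ?P (Bbar q) (Bbar (sort q))" by (simp add: D_def)
      moreover have "mset q = mset (sort q)" by simp
      ultimately show ?thesis using q sort_comps[OF q] unfolding rad_gens_def by blast
    next
      case False
      then have "\<exists>a>0. p \<le> count (mset q) a" by (simp add: reg_def not_less)
      moreover have "D q = Bbar q" using False by (simp add: D_def)
      ultimately show ?thesis using q unfolding rad_gens_def by blast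
    qed
    show "D q c mod ?P = D q c" for c using P by (simp add: D_def sig_diff_def Bbar_def)
  qed
  then have dS: "d \<in> ?S"
    unfolding d_def using mod_subspace_lincomb[OF mod_subspace_Fp_span _ finite_comps, where F = D] P by auto
  have "?S \<subseteq> ker_phi n ?P"
    using left_ideal_subspace[OF left_ideal_ker_phi] rad_gens_subset_ker_phi[OF p] P
    by (intro Fp_span_subset) auto
  then have dK: "d \<in> ker_phi n ?P" using dS by blast
  then have dcar: "d \<in> sig_carrier n ?P" by (simp add: ker_phi_def)
  define f' where "f' = sig_diff ?P f d"
  have f'K: "f' \<in> ker_phi n ?P"
    using f dK P by (simp add: f'_def ker_phi_def sig_carrier_sig_diff phi_sig_diff)
  \<comment> \<open>What remains at \<open>c\<close> is the total coefficient of the regular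
    compositions that sort to \<open>c\<close>.\<close>
  have f'c: "f' c = (\<Sum>q | q \<in> comps n \<and> reg q \<and> sort q = c. f q) mod ?P" if c: "c \<in> comps n" for c
  proof -
    define E where "E q = (if reg q \<and> sort q = c then f q else 0)" for q
    have Deq: "D q c mod ?P = (Bbar q c - (if reg q \<and> sort q = c then 1 else 0)) mod ?P" for q
      by (auto simp: D_def sig_diff_def Bbar_def)
    have "d c = (\<Sum>q\<in>comps n. (D q c mod ?P) * f q) mod ?P"
      unfolding sum_mod_mult_left by (simp add: d_def mult.commute)
    also have "\<dots> = (\<Sum>q\<in>comps n. (Bbar q c - (if reg q \<and> sort q = c then 1 else 0)) * f q) mod ?P"
      unfolding Deq sum_mod_mult_left ..
    also have "(\<Sum>q\<in>comps n. (Bbar q c - (if reg q \<and> sort q = c then 1 else 0)) * f q) =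
        (\<Sum>q\<in>comps n. (if q = c then f c else 0) - E q)"
      by (rule sum.cong) (auto simp: Bbar_def E_def)
    also have "\<dots> = f c - (\<Sum>q\<in>comps n. E q)"
      using c by (simp add: sum_subtractf finite_comps)
    finally have "f' c = (\<Sum>q\<in>comps n. E q) mod ?P"
      by (simp add: f'_def sig_diff_def mod_diff_right_eq)
    also have "(\<Sum>q\<in>comps n. E q) = (\<Sum>q | q \<in> comps n \<and> reg q \<and> sort q = c. f q)"
      by (rule sum.mono_neutral_cong_right) (auto simp: E_def finite_comps)
    finally show ?thesis .
  qed
  have "f' = sig_zero"
  proof (rule ker_phi_regular_sorted_zero[OF p f'K])
    fix c assume fc: "f' c \<noteq> 0"
    then have c: "c \<in> comps n" using f'K by (auto simp: ker_phi_def sig_carrier_def)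
    then have "{q. q \<in> comps n \<and> reg q \<and> sort q = c} \<noteq> {}" using f'c[OF c] fc by (metis mod_0 sum.empty)
    then obtain q where q: "q \<in> comps n" "reg q" "c = sort q" by blast
    \<comment> \<open>\<open>reg\<close> bounds the multiplicities of positive numbers only, and 0
      does not occur in a composition.\<close>
    have "count (mset c) a < p" for a
    proof (cases "a = 0")
      case True
      have "0 \<notin> set c" using c by (auto simp: comps_def)
      then show ?thesis using True P by (simp add: count_eq_zero_iff[THEN iffD2])
    next
      case False
      then show ?thesis using q by (simp add: reg_def)
    qed
    then show "sorted c \<and> (\<forall>a. count (mset c) a < p)" using q by simp
  qed
  then have zero: "sig_diff ?P f d c = 0" for c by (simp add: f'_def sig_zero_def)
  have "f = d"
  proof
    fix c
    have "(f c - d c) mod ?P = 0" using zero[of c] by (simp add: sig_diff_def)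
    then have "f c mod ?P = d c mod ?P" by (simp add: mod_eq_dvd_iff mod_eq_0_iff_dvd)
    then show "f c = d c" using fcar dcar by (simp add: sig_carrier_mod)
  qed
  then show "f \<in> ?S" using dS by simp
qed

theorem theorem2p6:
  fixes n p :: nat
  assumes "n \<ge> 1" and "prime p"
  shows "radical n (int p) = ker_phi n (int p)
       \<and> radical n (int p) = Fp_span (int p) (rad_gens n p)"
proof -
  have "int p > 0" using assms(2) prime_gt_0_nat by simp
  then have "Fp_span (int p) (rad_gens n p) \<subseteq> ker_phi n (int p)"
    by (intro Fp_span_subset left_ideal_subspace[OF left_ideal_ker_phi]
        rad_gens_subset_ker_phi assms(2))
  then show ?thesis
    using radical_eq_ker_phi[OF assms(2,1)] ker_phi_subset_span[OF assms(2)] by blast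
qed

end
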